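(* Let $Z$ be a paracompact Hausdorff space, $g\colon Z\to Z$ a continuous map and $K\subseteq Z$ a compact, asymptotically stable attractor for $g$ whose basin of attraction is all of $Z$. Then the induced endomorphism $g^*\colon\check H^*(Z,K;\mathbb K)\to\check H^*(Z,K;\mathbb K)$ has no nonzero eigenvalues.
   Context: $\check H^*$ denotes Čech (equivalently Alexander–Spanier) cohomology, with coefficients in a field $\mathbb K$ ($\mathbb Q$ or $\mathbb C$). That $K$ is a compact asymptotically stable attractor with basin of attraction $Z$ means: (i) $K$ has a neighbourhood basis consisting of positively invariant sets $P$ (i.e. $g(P)\subseteq P$), so that in particular $g(K)\subseteq K$; and (ii) for every $p\in Z$ and every neighbourhood $P$ of $K$ there is $n_0$ with $g^{n_0}(p)\in P$. *)

theory Defs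
  imports "HOL-Analysis.Abstract_Topological_Spaces" "HOL-Algebra.AbelCoset" "HOL-Algebra.Module"
begin

section \<open>Paracompactness and attractors\<close>

definition paracompact_space :: "'a topology \<Rightarrow> bool" where
  "paracompact_space X \<longleftrightarrow>
     (\<forall>\<U>. (\<forall>U\<in>\<U>. openin X U) \<and> \<Union>\<U> = topspace X \<longrightarrow>
        (\<exists>\<V>. (\<forall>V\<in>\<V>. openin X V) \<and> \<Union>\<V> = topspace X \<and>
             (\<forall>V\<in>\<V>. \<exists>U\<in>\<U>. V \<subseteq> U) \<and> locally_finite_in X \<V>))"

text \<open>Neighbourhoods of a set need not be open.\<close>

definition neighbourhood_of :: "'a topology \<Rightarrow> 'a set \<Rightarrow> 'a set \<Rightarrow> bool" where
  "neighbourhood_of X K P \<longleftrightarrow>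
     P \<subseteq> topspace X \<and> (\<exists>U. openin X U \<and> K \<subseteq> U \<and> U \<subseteq> P)"

definition asymptotically_stable_attractor ::
    "'a topology \<Rightarrow> ('a \<Rightarrow> 'a) \<Rightarrow> 'a set \<Rightarrow> bool" where
  \<comment> \<open>The basin of attraction is all of \<^term>\<open>topspace X\<close>.\<close>
  "asymptotically_stable_attractor X g K \<longleftrightarrow>
     compactin X K \<and>
     (\<forall>N. neighbourhood_of X K N \<longrightarrow>
        (\<exists>P. neighbourhood_of X K P \<and> P \<subseteq> N \<and> g ` P \<subseteq> P)) \<and>
     (\<forall>p\<in>topspace X. \<forall>P. neighbourhood_of X K P \<longrightarrow> (\<exists>n. (g ^^ n) p \<in> P))"

section \<open>Linear algebra\<close>

text \<open>The scalars of a \<^typ>\<open>('k, 'v) module\<close> are here always all of the field type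
  \<^typ>\<open>'k\<close>; the multiplicative fields of the record are irrelevant.\<close>

definition quotient_module :: "('k, 'v) module \<Rightarrow> 'v set \<Rightarrow> ('k, 'v set) module" where
  "quotient_module M N =
     \<lparr>carrier = a_rcosets\<^bsub>M\<^esub> N, mult = undefined, one = undefined,
      zero = N, add = (\<lambda>S T. S <+>\<^bsub>M\<^esub> T),
      smult = (\<lambda>c S. \<Union>x\<in>S. N +>\<^bsub>M\<^esub> (c \<odot>\<^bsub>M\<^esub> x))\<rparr>"

text \<open>The map into \<^term>\<open>quotient_module M N\<close> induced by \<open>f\<close>: it sends the coset of \<open>x\<close>
  to the coset of \<open>f x\<close>.\<close>

definition quotient_map_to ::
    "('k, 'v) module \<Rightarrow> 'v set \<Rightarrow> ('u \<Rightarrow> 'v) \<Rightarrow> 'u set \<Rightarrow> 'v set" where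
  "quotient_map_to M N f = (\<lambda>S. \<Union>x\<in>S. N +>\<^bsub>M\<^esub> f x)"

definition is_eigenvalue :: "('k, 'v) module \<Rightarrow> ('v \<Rightarrow> 'v) \<Rightarrow> 'k \<Rightarrow> bool" where
  "is_eigenvalue M T \<mu> \<longleftrightarrow>
     (\<exists>v\<in>carrier M. v \<noteq> \<zero>\<^bsub>M\<^esub> \<and> T v = \<mu> \<odot>\<^bsub>M\<^esub> v)"

section \<open>Alexander--Spanier cohomology of a pair\<close>

definition tuples :: "nat \<Rightarrow> 'a set \<Rightarrow> 'a list set" where
  "tuples q S = {xs. length xs = Suc q \<and> set xs \<subseteq> S}"

text \<open>A \<open>q\<close>-cochain is an arbitrary function on \<open>(q+1)\<close>-tuples of points of the space,
  represented by its extension by zero to all lists.\<close>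

definition cochains :: "nat \<Rightarrow> 'a topology \<Rightarrow> ('a list \<Rightarrow> 'k::field) set" where
  "cochains q X = {\<phi>. \<forall>xs. xs \<notin> tuples q (topspace X) \<longrightarrow> \<phi> xs = 0}"

definition locally_zero :: "nat \<Rightarrow> 'a topology \<Rightarrow> ('a list \<Rightarrow> 'k::field) \<Rightarrow> bool" where
  "locally_zero q X \<phi> \<longleftrightarrow>
     (\<exists>\<U>. (\<forall>U\<in>\<U>. openin X U) \<and> \<Union>\<U> = topspace X \<and>
          (\<forall>U\<in>\<U>. \<forall>xs\<in>tuples q U. \<phi> xs = 0))"

definition coboundary ::
    "nat \<Rightarrow> 'a topology \<Rightarrow> ('a list \<Rightarrow> 'k::field) \<Rightarrow> 'a list \<Rightarrow> 'k" where
  "coboundary q X \<phi> = (\<lambda>xs. if xs \<in> tuples (Suc q) (topspace X)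
     then \<Sum>i\<le>Suc q. (-1) ^ i * \<phi> (take i xs @ drop (Suc i) xs) else 0)"

definition pullback ::
    "nat \<Rightarrow> 'a topology \<Rightarrow> ('a \<Rightarrow> 'b) \<Rightarrow> ('b list \<Rightarrow> 'k::field) \<Rightarrow> 'a list \<Rightarrow> 'k" where
  "pullback q X f \<phi> = (\<lambda>xs. if xs \<in> tuples q (topspace X) then \<phi> (map f xs) else 0)"

text \<open>Following Spanier, the Alexander--Spanier complex of \<open>(X, A)\<close> is the quotient of the
  complex of cochains of \<open>X\<close> that are locally zero on \<open>A\<close> by the subcomplex of cochains that
  are locally zero on \<open>X\<close>; equivalently, it is the kernel of the restriction from the
  absolute complex of \<open>X\<close> to that of \<open>A\<close>.\<close>

definition rel_cochains ::
    "nat \<Rightarrow> 'a topology \<Rightarrow> 'a set \<Rightarrow> ('k::field, 'a list \<Rightarrow> 'k) module" where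
  "rel_cochains q X A =
     \<lparr>carrier = {\<phi> \<in> cochains q X. locally_zero q (subtopology X A) \<phi>},
      mult = undefined, one = undefined,
      zero = (\<lambda>xs. 0), add = (\<lambda>\<phi> \<psi> xs. \<phi> xs + \<psi> xs),
      smult = (\<lambda>c \<phi> xs. c * \<phi> xs)\<rparr>"

definition null_cochains :: "nat \<Rightarrow> 'a topology \<Rightarrow> ('a list \<Rightarrow> 'k::field) set" where
  "null_cochains q X = {\<phi> \<in> cochains q X. locally_zero q X \<phi>}"

definition AS_cochains ::
    "nat \<Rightarrow> 'a topology \<Rightarrow> 'a set \<Rightarrow> ('k::field, ('a list \<Rightarrow> 'k) set) module" where
  "AS_cochains q X A = quotient_module (rel_cochains q X A) (null_cochains q X)"

definition AS_coboundary ::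
    "nat \<Rightarrow> 'a topology \<Rightarrow> 'a set \<Rightarrow> ('a list \<Rightarrow> 'k::field) set \<Rightarrow> ('a list \<Rightarrow> 'k) set" where
  "AS_coboundary q X A =
     quotient_map_to (rel_cochains (Suc q) X A) (null_cochains (Suc q) X) (coboundary q X)"

definition AS_pullback ::
    "nat \<Rightarrow> 'a topology \<Rightarrow> 'a set \<Rightarrow> ('a \<Rightarrow> 'b) \<Rightarrow>
       ('b list \<Rightarrow> 'k::field) set \<Rightarrow> ('a list \<Rightarrow> 'k) set" where
  "AS_pullback q X A f =
     quotient_map_to (rel_cochains q X A) (null_cochains q X) (pullback q X f)"

definition AS_cocycles ::
    "nat \<Rightarrow> 'a topology \<Rightarrow> 'a set \<Rightarrow> ('k::field, ('a list \<Rightarrow> 'k) set) module" where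
  "AS_cocycles q X A = (AS_cochains q X A)
     \<lparr>carrier := {c \<in> carrier (AS_cochains q X A).
        AS_coboundary q X A c = \<zero>\<^bsub>AS_cochains (Suc q) X A\<^esub>}\<rparr>"

definition AS_coboundaries ::
    "nat \<Rightarrow> 'a topology \<Rightarrow> 'a set \<Rightarrow> ('a list \<Rightarrow> 'k::field) set set" where
  "AS_coboundaries q X A = (case q of
       0 \<Rightarrow> {\<zero>\<^bsub>AS_cochains 0 X A\<^esub>}
     | Suc p \<Rightarrow> AS_coboundary p X A ` carrier (AS_cochains p X A))"

definition AS_cohomology ::
    "nat \<Rightarrow> 'a topology \<Rightarrow> 'a set \<Rightarrow> ('k::field, ('a list \<Rightarrow> 'k) set set) module" where
  "AS_cohomology q X A = quotient_module (AS_cocycles q X A) (AS_coboundaries q X A)"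

text \<open>The homomorphism from degree \<open>q\<close> cohomology of a pair \<open>(Y, B)\<close> to that of \<open>(X, A)\<close>
  induced by a map of pairs \<open>f\<close> from \<open>(X, A)\<close> to \<open>(Y, B)\<close>. The formula mentions only
  \<open>(X, A)\<close>.\<close>

definition AS_induced ::
    "nat \<Rightarrow> 'a topology \<Rightarrow> 'a set \<Rightarrow> ('a \<Rightarrow> 'b) \<Rightarrow>
       ('b list \<Rightarrow> 'k::field) set set \<Rightarrow> ('a list \<Rightarrow> 'k) set set" where
  "AS_induced q X A f =
     quotient_map_to (AS_cocycles q X A) (AS_coboundaries q X A) (AS_pullback q X A f)"

end

theory Submission
  imports Defs "HOL-Library.Groups_Big_Fun"
begin

text \<open>
  Let \<open>\<phi>\<close> be a relative cocycle whose class is an eigenvector for \<open>\<mu> \<noteq> 0\<close>, so that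
  \<open>g\<^sup>* \<phi> - \<mu> \<phi> = \<delta> \<beta>\<close> up to a cochain that is zero in cohomology because it is locally zero.
  Suppose that \<open>\<phi>\<close> and \<open>\<beta>\<close> vanish on all tuples of points of some positively invariant
  neighbourhood \<open>P\<close> of \<open>K\<close>. Solving the equation for \<open>\<phi>\<close> and iterating gives
  \<open>\<phi> = - \<delta> (\<Sum>n. \<mu>\<^sup>-\<^sup>(\<^sup>n\<^sup>+\<^sup>1\<^sup>) (g\<^sup>n)\<^sup>* \<beta>)\<close>,
  again up to a locally zero cochain. The sum makes sense because every point of the space has a
  neighbourhood that some iterate \<open>g\<^sup>k\<close> sends into \<open>P\<close>; there all terms with \<open>n \<ge> k\<close> vanish,
  and so does the remainder \<open>\<mu>\<^sup>-\<^sup>k (g\<^sup>k)\<^sup>* \<phi>\<close> of the telescoping. Since the sum vanishes on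
  \<open>P\<close>, it is a relative cochain and the class of \<open>\<phi>\<close> is zero. This is
  \<open>eigencochain_vanishing_near_attractor\<close>.

  It remains to arrange the vanishing near \<open>K\<close>, which is the cochain-level form of the tautness
  of \<open>K\<close>. A relative cochain \<open>\<phi>\<close> vanishes only on small tuples of points of \<open>K\<close> itself, and
  nothing is known about it at nearby points outside \<open>K\<close>. If, however, \<open>\<delta> \<phi>\<close> is locally zero near
  \<open>K\<close>, then by the prism homotopy \<open>\<phi>\<close> differs from \<open>f\<^sup>* \<phi>\<close> near \<open>K\<close> by a coboundary and a locally
  zero function, for every map \<open>f\<close>, continuous or not, that moves points by little. A map \<open>f\<close> from a neighbourhood of \<open>K\<close> into
  \<open>K\<close> that moves points by little exists by compactness (\<open>small_map_into_compact\<close>), and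
  \<open>f\<^sup>* \<phi>\<close> is locally zero. Together this is \<open>rel_cochain_vanishing_near_compact\<close>. It is applied
  first to \<open>\<phi>\<close>; after that \<open>g\<^sup>* \<phi> - \<mu> \<phi>\<close> vanishes near \<open>K\<close>, hence \<open>\<delta> \<beta>\<close> is locally zero near
  \<open>K\<close>, and it can be applied to \<open>\<beta>\<close>.

  Throughout, cochains are replaced by arbitrary functions on lists, and the number of entries
  of a tuple, not the degree of a cochain, is counted. Degree \<open>q\<close> thus corresponds to length
  \<open>q + 1\<close>. A \<open>\<beta>\<close> with \<open>\<delta> \<beta>\<close> of degree \<open>0\<close> then lives on the empty list, where
  \<open>K \<noteq> {}\<close> forces it to be \<open>0\<close>, so that degree \<open>0\<close> needs no separate treatment of the dynamics.
\<close>

section \<open>The alternating face sum and the prism homotopy\<close>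

text \<open>The coboundary formula, by recursion on the tuple: omitting the first entry gives
  \<open>\<phi> xs\<close>, and the other faces are those of \<open>xs\<close> with \<open>x\<close> put in front, with opposite sign. Having
  one function for all degrees makes the identities below plain list inductions.\<close>

primrec delta :: "('a list \<Rightarrow> 'k::comm_ring_1) \<Rightarrow> 'a list \<Rightarrow> 'k" where
  "delta \<phi> [] = 0"
| "delta \<phi> (x # xs) = \<phi> xs - delta (\<lambda>ys. \<phi> (x # ys)) xs"

lemma delta_eq_sum:
  "delta \<phi> xs = (\<Sum>i<length xs. (-1) ^ i * \<phi> (take i xs @ drop (Suc i) xs))"
proof (induction xs arbitrary: \<phi>)
  case (Cons x xs)
  show ?case
    by (simp add: Cons.IH sum.lessThan_Suc_shift sum_negf del: sum.lessThan_Suc)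
qed simp

lemma delta_cong:
  assumes "\<And>ys. length xs = Suc (length ys) \<Longrightarrow> set ys \<subseteq> set xs \<Longrightarrow> \<phi> ys = \<psi> ys"
  shows "delta \<phi> xs = delta \<psi> xs"
  using assms
proof (induction xs arbitrary: \<phi> \<psi>)
  case (Cons x xs)
  have "delta (\<lambda>ys. \<phi> (x # ys)) xs = delta (\<lambda>ys. \<psi> (x # ys)) xs"
  proof (rule Cons.IH)
    fix ys assume "length xs = Suc (length ys)" "set ys \<subseteq> set xs"
    then show "\<phi> (x # ys) = \<psi> (x # ys)"
      by (intro Cons.prems) auto
  qed
  moreover have "\<phi> xs = \<psi> xs"
    using Cons.prems by auto
  ultimately show ?case by simp
qed simp

lemma delta_diff: "delta (\<lambda>ys. \<phi> ys - \<psi> ys) xs = delta \<phi> xs - delta \<psi> xs"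
  by (simp add: delta_eq_sum sum_subtractf algebra_simps)

lemma delta_add: "delta (\<lambda>ys. \<phi> ys + \<psi> ys) xs = delta \<phi> xs + delta \<psi> xs"
  by (simp add: delta_eq_sum sum.distrib algebra_simps)

lemma delta_smult: "delta (\<lambda>ys. c * \<phi> ys) xs = c * delta \<phi> xs"
  by (simp add: delta_eq_sum sum_distrib_left algebra_simps)

lemma delta_zero [simp]: "delta (\<lambda>ys. 0) xs = 0"
  by (simp add: delta_eq_sum)

lemma delta_sum: "delta (\<lambda>ys. \<Sum>i\<in>I. \<phi> i ys) xs = (\<Sum>i\<in>I. delta (\<phi> i) xs)"
  by (simp add: delta_eq_sum sum_distrib_left) (rule sum.swap)

lemma delta_map: "delta (\<lambda>ys. \<phi> (map h ys)) xs = delta \<phi> (map h xs)"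
  by (induction xs arbitrary: \<phi>) auto

lemma delta_delta: "delta (delta \<phi>) xs = 0"
  by (induction xs arbitrary: \<phi>) (auto simp: delta_diff)

text \<open>The prism operator: the alternating sum over \<open>i\<close> of the values of \<open>\<phi>\<close> at
  \<open>(x\<^sub>0, \<dots>, x\<^sub>i, f x\<^sub>i, \<dots>, f x\<^sub>m)\<close>.\<close>

primrec prism :: "('a \<Rightarrow> 'a) \<Rightarrow> ('a list \<Rightarrow> 'k::comm_ring_1) \<Rightarrow> 'a list \<Rightarrow> 'k" where
  "prism f \<phi> [] = 0"
| "prism f \<phi> (x # xs) = \<phi> (x # f x # map f xs) - prism f (\<lambda>ys. \<phi> (x # ys)) xs"

lemma prism_diff: "prism f (\<lambda>ys. \<phi> ys - \<psi> ys) xs = prism f \<phi> xs - prism f \<psi> xs"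
  by (induction xs arbitrary: \<phi> \<psi>) auto

lemma prism_eq_0:
  assumes "\<And>ys. length ys = Suc (length xs) \<Longrightarrow> set ys \<subseteq> set xs \<union> f ` set xs \<Longrightarrow> \<phi> ys = 0"
  shows "prism f \<phi> xs = 0"
  using assms
proof (induction xs arbitrary: \<phi>)
  case (Cons x xs)
  have "prism f (\<lambda>ys. \<phi> (x # ys)) xs = 0"
  proof (rule Cons.IH)
    fix ys assume "length ys = Suc (length xs)" "set ys \<subseteq> set xs \<union> f ` set xs"
    then show "\<phi> (x # ys) = 0"
      by (intro Cons.prems) auto
  qed
  moreover have "\<phi> (x # f x # map f xs) = 0"
    by (rule Cons.prems) auto
  ultimately show ?case by simp
qed simp

text \<open>Pullback along any function is chain homotopic to the identity. Alexander--Spanier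
  cochains see the topology only through which tuples count as small, and so \<open>f\<close> may be
  discontinuous.\<close>

lemma prism_homotopy:
  "delta (prism f \<phi>) xs + prism f (delta \<phi>) xs = \<phi> (map f xs) - \<phi> xs"
proof (induction xs arbitrary: \<phi>)
  case (Cons x xs)
  let ?\<psi> = "\<lambda>ys. \<phi> (x # ys)" and ?\<omega> = "\<lambda>ys. \<phi> (x # f x # ys)"
  have "delta (\<lambda>ys. ?\<omega> (map f ys)) xs = delta ?\<omega> (map f xs)"
    by (rule delta_map)
  then have "delta (prism f \<phi>) (x # xs)
      = prism f \<phi> xs - (delta ?\<omega> (map f xs) - delta (prism f ?\<psi>) xs)"
    by (simp add: delta_diff)
  moreover have "prism f (delta \<phi>) (x # xs)
      = \<phi> (map f (x # xs)) - (?\<psi> (map f xs) - delta ?\<omega> (map f xs))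
        - (prism f \<phi> xs - prism f (delta ?\<psi>) xs)"
    by (simp add: prism_diff)
  moreover have "delta (prism f ?\<psi>) xs = ?\<psi> (map f xs) - ?\<psi> xs - prism f (delta ?\<psi>) xs"
    using Cons.IH[of ?\<psi>] by (simp add: eq_diff_eq)
  ultimately show ?case by simp
qed simp

section \<open>Functions that vanish on all small tuples\<close>

definition tups :: "nat \<Rightarrow> 'a set \<Rightarrow> 'a list set" where
  "tups n S = {xs. length xs = n \<and> set xs \<subseteq> S}"

text \<open>The common form of the two vanishing conditions on cochains: \<open>A\<close> is the subspace
  of a pair for relative cochains, and \<^term>\<open>UNIV\<close> for cochains that represent zero.\<close>

definition loc_zero :: "nat \<Rightarrow> 'a topology \<Rightarrow> 'a set \<Rightarrow> ('a list \<Rightarrow> 'k::zero) \<Rightarrow> bool" where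
  "loc_zero n X A \<phi> \<longleftrightarrow>
     (\<forall>x\<in>topspace X \<inter> A. \<exists>U. openin X U \<and> x \<in> U \<and> (\<forall>xs\<in>tups n (U \<inter> A). \<phi> xs = 0))"

lemma tuples_eq_tups: "tuples q = tups (Suc q)"
  by (auto simp: tuples_def tups_def)

lemma tups_mono: "S \<subseteq> T \<Longrightarrow> xs \<in> tups n S \<Longrightarrow> xs \<in> tups n T"
  by (auto simp: tups_def)

lemma locally_zero_iff:
  "locally_zero q (subtopology X A) \<phi> \<longleftrightarrow> loc_zero (Suc q) X A \<phi>"
proof
  assume "locally_zero q (subtopology X A) \<phi>"
  then obtain \<U> where U: "\<forall>U\<in>\<U>. openin (subtopology X A) U"
      "\<Union>\<U> = topspace (subtopology X A)" "\<forall>U\<in>\<U>. \<forall>xs\<in>tuples q U. \<phi> xs = 0"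
    unfolding locally_zero_def by (elim exE conjE)
  show "loc_zero (Suc q) X A \<phi>"
    unfolding loc_zero_def
  proof
    fix x assume "x \<in> topspace X \<inter> A"
    then obtain W where W: "W \<in> \<U>" "x \<in> W" using U(2) by auto
    then obtain T where "openin X T" "W = T \<inter> A"
      using U(1) by (auto simp: openin_subtopology)
    then show "\<exists>U. openin X U \<and> x \<in> U \<and> (\<forall>xs\<in>tups (Suc q) (U \<inter> A). \<phi> xs = 0)"
      using W U(3) by (intro exI[of _ T]) (auto simp: tuples_eq_tups)
  qed
next
  assume l: "loc_zero (Suc q) X A \<phi>"
  define \<U> where "\<U> = {U \<inter> A |U. openin X U \<and> (\<forall>xs\<in>tups (Suc q) (U \<inter> A). \<phi> xs = 0)}"
  have "\<Union>\<U> = topspace (subtopology X A)"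
  proof
    show "\<Union>\<U> \<subseteq> topspace (subtopology X A)"
      using openin_subset by (fastforce simp: \<U>_def)
    show "topspace (subtopology X A) \<subseteq> \<Union>\<U>"
    proof
      fix x assume "x \<in> topspace (subtopology X A)"
      then obtain U where "openin X U" "x \<in> U" "x \<in> A" "\<forall>xs\<in>tups (Suc q) (U \<inter> A). \<phi> xs = 0"
        using l unfolding loc_zero_def by auto
      then show "x \<in> \<Union>\<U>"
        unfolding \<U>_def by blast
    qed
  qed
  moreover have "\<forall>U\<in>\<U>. openin (subtopology X A) U"
    by (auto simp: \<U>_def openin_subtopology)
  ultimately show "locally_zero q (subtopology X A) \<phi>"
    unfolding locally_zero_def
    by (intro exI[of _ \<U>]) (auto simp: \<U>_def tuples_eq_tups)
qed

lemma locally_zero_absolute_iff: "locally_zero q X \<phi> \<longleftrightarrow> loc_zero (Suc q) X UNIV \<phi>"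
  using locally_zero_iff[of q X UNIV \<phi>] by simp

lemma loc_zeroI:
  assumes "\<And>x. x \<in> topspace X \<Longrightarrow> x \<in> A \<Longrightarrow>
    \<exists>U. openin X U \<and> x \<in> U \<and> (\<forall>xs\<in>tups n (U \<inter> A). \<phi> xs = 0)"
  shows "loc_zero n X A \<phi>"
  using assms by (auto simp: loc_zero_def)

lemma loc_zeroD:
  assumes "loc_zero n X A \<phi>" "x \<in> topspace X" "x \<in> A"
  shows "\<exists>U. openin X U \<and> x \<in> U \<and> (\<forall>xs\<in>tups n (U \<inter> A). \<phi> xs = 0)"
  using assms by (auto simp: loc_zero_def)

lemma loc_zero_mono:
  assumes "loc_zero n X B \<phi>" "A \<subseteq> B"
  shows "loc_zero n X A \<phi>"
proof (rule loc_zeroI)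
  fix x assume x: "x \<in> topspace X" "x \<in> A"
  obtain U where U: "openin X U" "x \<in> U" "\<And>xs. xs \<in> tups n (U \<inter> B) \<Longrightarrow> \<phi> xs = 0"
    using loc_zeroD[OF assms(1) x(1)] x(2) assms(2) by blast
  have "\<phi> xs = 0" if "xs \<in> tups n (U \<inter> A)" for xs
    by (rule U(3)) (use that assms(2) in \<open>auto simp: tups_def\<close>)
  then show "\<exists>U. openin X U \<and> x \<in> U \<and> (\<forall>xs\<in>tups n (U \<inter> A). \<phi> xs = 0)"
    using U(1,2) by blast
qed

lemma loc_zero_zero [simp]: "loc_zero n X A (\<lambda>xs. 0)"
  by (auto simp: loc_zero_def)

lemma loc_zero_cong:
  assumes "loc_zero n X A \<phi>" "\<And>xs. xs \<in> tups n (topspace X \<inter> A) \<Longrightarrow> \<psi> xs = \<phi> xs"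
  shows "loc_zero n X A \<psi>"
proof (rule loc_zeroI)
  fix x assume x: "x \<in> topspace X" "x \<in> A"
  obtain U where U: "openin X U" "x \<in> U" "\<And>xs. xs \<in> tups n (U \<inter> A) \<Longrightarrow> \<phi> xs = 0"
    using loc_zeroD[OF assms(1) x] by blast
  have zero: "\<psi> xs = 0" if xs: "xs \<in> tups n (U \<inter> A)" for xs
  proof -
    have "xs \<in> tups n (topspace X \<inter> A)"
      using xs openin_subset[OF U(1)] by (auto simp: tups_def)
    then show ?thesis using assms(2) U(3)[OF xs] by simp
  qed
  show "\<exists>U. openin X U \<and> x \<in> U \<and> (\<forall>xs\<in>tups n (U \<inter> A). \<psi> xs = 0)"
    using U(1,2) zero by blast
qed

lemma loc_zero_combine:
  assumes "loc_zero n X A \<phi>" "loc_zero n X A \<psi>"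
    and "\<And>xs. \<phi> xs = 0 \<Longrightarrow> \<psi> xs = 0 \<Longrightarrow> \<theta> xs = 0"
  shows "loc_zero n X A \<theta>"
proof (rule loc_zeroI)
  fix x assume x: "x \<in> topspace X" "x \<in> A"
  obtain U where U: "openin X U" "x \<in> U" "\<And>xs. xs \<in> tups n (U \<inter> A) \<Longrightarrow> \<phi> xs = 0"
    using loc_zeroD[OF assms(1) x] by blast
  obtain V where V: "openin X V" "x \<in> V" "\<And>xs. xs \<in> tups n (V \<inter> A) \<Longrightarrow> \<psi> xs = 0"
    using loc_zeroD[OF assms(2) x] by blast
  have "\<theta> xs = 0" if "xs \<in> tups n ((U \<inter> V) \<inter> A)" for xs
    by (rule assms(3)[OF U(3) V(3)]) (use that in \<open>auto simp: tups_def\<close>)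
  then show "\<exists>U. openin X U \<and> x \<in> U \<and> (\<forall>xs\<in>tups n (U \<inter> A). \<theta> xs = 0)"
    using U V by (intro exI[of _ "U \<inter> V"]) auto
qed

lemma loc_zero_add:
  "loc_zero n X A \<phi> \<Longrightarrow> loc_zero n X A \<psi> \<Longrightarrow> loc_zero n X A (\<lambda>xs. \<phi> xs + \<psi> xs :: 'k::comm_ring_1)"
  by (rule loc_zero_combine[of n X A \<phi> \<psi>]) auto

lemma loc_zero_diff:
  "loc_zero n X A \<phi> \<Longrightarrow> loc_zero n X A \<psi> \<Longrightarrow> loc_zero n X A (\<lambda>xs. \<phi> xs - \<psi> xs :: 'k::comm_ring_1)"
  by (rule loc_zero_combine[of n X A \<phi> \<psi>]) auto

lemma loc_zero_smult:
  "loc_zero n X A \<phi> \<Longrightarrow> loc_zero n X A (\<lambda>xs. c * \<phi> xs :: 'k::comm_ring_1)"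
  by (rule loc_zero_combine[of n X A \<phi> \<phi>]) auto

lemma loc_zero_sum:
  assumes "\<And>i. i \<in> I \<Longrightarrow> loc_zero n X A (\<phi> i)"
  shows "loc_zero n X A (\<lambda>xs. \<Sum>i\<in>I. \<phi> i xs :: 'k::comm_ring_1)"
  using assms by (induction I rule: infinite_finite_induct) (auto intro: loc_zero_add)

lemma loc_zero_delta:
  assumes "loc_zero n X A \<phi>"
  shows "loc_zero (Suc n) X A (delta \<phi>)"
proof (rule loc_zeroI)
  fix x assume x: "x \<in> topspace X" "x \<in> A"
  obtain U where U: "openin X U" "x \<in> U" "\<And>xs. xs \<in> tups n (U \<inter> A) \<Longrightarrow> \<phi> xs = 0"
    using loc_zeroD[OF assms(1) x] by blast
  have "delta \<phi> xs = 0" if "xs \<in> tups (Suc n) (U \<inter> A)" for xs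
    using delta_cong[of xs \<phi> "\<lambda>_. 0"] U(3) that by (auto simp: tups_def)
  then show "\<exists>U. openin X U \<and> x \<in> U \<and> (\<forall>xs\<in>tups (Suc n) (U \<inter> A). delta \<phi> xs = 0)"
    using U by blast
qed

lemma loc_zero_pullback:
  assumes "loc_zero n X A \<phi>" "continuous_map X X g" "g ` (topspace X \<inter> A) \<subseteq> A"
  shows "loc_zero n X A (\<lambda>xs. \<phi> (map g xs))"
proof (rule loc_zeroI)
  fix x assume x: "x \<in> topspace X" "x \<in> A"
  have gx: "g x \<in> topspace X" "g x \<in> A"
    using x assms(2,3) continuous_map_funspace by blast+
  obtain U where U: "openin X U" "g x \<in> U" "\<And>xs. xs \<in> tups n (U \<inter> A) \<Longrightarrow> \<phi> xs = 0"
    using loc_zeroD[OF assms(1) gx] by blast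
  let ?V = "{y \<in> topspace X. g y \<in> U}"
  have "openin X ?V"
    by (rule openin_continuous_map_preimage[OF assms(2) U(1)])
  moreover have "\<phi> (map g xs) = 0" if "xs \<in> tups n (?V \<inter> A)" for xs
    by (rule U(3)) (use that assms(3) in \<open>auto simp: tups_def\<close>)
  ultimately show "\<exists>U. openin X U \<and> x \<in> U \<and> (\<forall>xs\<in>tups n (U \<inter> A). \<phi> (map g xs) = 0)"
    using x U(2) by (intro exI[of _ ?V]) auto
qed

section \<open>Separation\<close>

text \<open>For a closed set \<open>C\<close> and a point \<open>a\<close> outside it, cover \<open>C\<close> by open sets whose
  closures miss \<open>a\<close>. In a locally finite refinement the closure of the union of the members that meet
  \<open>C\<close> is the union of their closures, and so misses \<open>a\<close> too.\<close>

lemma paracompact_Hausdorff_imp_regular_space: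
  assumes "paracompact_space X" "Hausdorff_space X"
  shows "regular_space X"
  unfolding regular_space
proof clarify
  fix C a assume C: "closedin X C" and a: "a \<in> topspace X" "a \<notin> C"
  define \<U> where "\<U> = insert (topspace X - C) {U. openin X U \<and> a \<notin> X closure_of U}"
  have sep: "\<exists>U. openin X U \<and> c \<in> U \<and> a \<notin> X closure_of U" if "c \<in> C" for c
  proof -
    have "c \<in> topspace X" "c \<noteq> a" using that C a closedin_subset by blast+
    then obtain U V where "openin X U" "openin X V" "c \<in> U" "a \<in> V" "disjnt U V"
      using assms(2) a unfolding Hausdorff_space_def by blast
    then show ?thesis
      by (intro exI[of _ U]) (auto simp: in_closure_of disjnt_iff)
  qed
  have "\<forall>U\<in>\<U>. openin X U"
    using C by (auto simp: \<U>_def)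
  moreover have "\<Union>\<U> = topspace X"
    using sep openin_subset by (force simp: \<U>_def)
  ultimately have "\<exists>\<V>. (\<forall>V\<in>\<V>. openin X V) \<and> \<Union>\<V> = topspace X \<and>
      (\<forall>V\<in>\<V>. \<exists>U\<in>\<U>. V \<subseteq> U) \<and> locally_finite_in X \<V>"
    using assms(1) by (simp add: paracompact_space_def)
  then obtain \<V> where V: "\<forall>V\<in>\<V>. openin X V" "\<Union>\<V> = topspace X"
      "\<forall>V\<in>\<V>. \<exists>U\<in>\<U>. V \<subseteq> U" "locally_finite_in X \<V>"
    by (elim exE conjE)
  define \<W> where "\<W> = {V \<in> \<V>. V \<inter> C \<noteq> {}}"
  have lf: "locally_finite_in X \<W>"
    by (rule locally_finite_in_subset[OF V(4)]) (auto simp: \<W>_def)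
  have "a \<notin> X closure_of W" if W: "W \<in> \<W>" for W
  proof -
    obtain U where U: "U \<in> \<U>" "W \<subseteq> U" using W V(3) by (auto simp: \<W>_def)
    then have "a \<notin> X closure_of U" using W by (auto simp: \<U>_def \<W>_def)
    then show ?thesis using closure_of_mono[OF U(2)] by blast
  qed
  then have na: "a \<notin> X closure_of \<Union>\<W>"
    by (simp add: closure_of_locally_finite_Union[OF lf])
  have op: "openin X (\<Union>\<W>)" using V(1) by (auto simp: \<W>_def)
  have "C \<subseteq> \<Union>\<W>" using V(2) closedin_subset[OF C] unfolding \<W>_def by blast
  moreover have "\<Union>\<W> \<inter> X closure_of (topspace X - X closure_of \<Union>\<W>) = {}"
    unfolding openin_Int_closure_of_eq_empty[OF op]
    using closure_of_subset[OF openin_subset[OF op]] by blast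
  ultimately have "disjnt C (X closure_of (topspace X - X closure_of \<Union>\<W>))"
    by (auto simp: disjnt_iff)
  then show "\<exists>U. openin X U \<and> a \<in> U \<and> disjnt C (X closure_of U)"
    using na a by (intro exI[of _ "topspace X - X closure_of \<Union>\<W>"]) auto
qed

lemma shrink_neighbourhood_of_compact:
  assumes "regular_space X" "compactin X K" "openin X N" "K \<subseteq> N"
  obtains M where "openin X M" "K \<subseteq> M" "X closure_of M \<subseteq> N"
proof -
  have "closedin X (topspace X - N)" "disjnt K (topspace X - N)"
    using assms by (auto simp: disjnt_iff)
  then obtain U V where "openin X U" "openin X V" "K \<subseteq> U" "topspace X - N \<subseteq> V" "disjnt U V"
    using regular_space_compact_closed_separation[OF assms(1,2)] by metis
  then show ?thesis
    by (intro that[of U]) (auto simp: in_closure_of disjnt_iff subset_iff)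
qed

text \<open>Each \<open>p \<in> K\<close> has an open neighbourhood \<open>G p\<close> inside a member \<open>U p\<close> of \<open>\<U>\<close>, so small that
  \<open>K\<close> meets its closure only inside \<open>U p\<close>. Finitely many of the \<open>G p\<close> cover \<open>K\<close>. For \<open>z \<in> K\<close> let
  \<open>S z\<close> be the complement of the closures of those of them with \<open>z \<notin> U p\<close>; it is an open
  neighbourhood of \<open>z\<close>. A choice of \<open>f x \<in> K\<close> with \<open>x \<in> S (f x)\<close> has the property that
  \<open>x \<in> G p\<close> implies \<open>f x \<in> U p\<close>, so that both \<open>G p\<close> and its image lie in \<open>U p\<close>.\<close>

lemma small_map_into_compact:
  assumes "Hausdorff_space X" "compactin X K"
    and "\<And>U. U \<in> \<U> \<Longrightarrow> openin X U" "K \<subseteq> \<Union>\<U>"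
  obtains N f where "openin X N" "K \<subseteq> N" "f ` N \<subseteq> K"
    "\<forall>x\<in>N. \<exists>V U. openin X V \<and> x \<in> V \<and> V \<subseteq> N \<and> U \<in> \<U> \<and> V \<union> f ` V \<subseteq> U"
proof -
  have KX: "K \<subseteq> topspace X" using assms(2) compactin_subset_topspace by blast
  have "\<exists>G U. openin X G \<and> p \<in> G \<and> U \<in> \<U> \<and> G \<subseteq> U \<and> K \<inter> X closure_of G \<subseteq> U"
    if p: "p \<in> K" for p
  proof -
    obtain U where U: "U \<in> \<U>" "p \<in> U" using p assms(4) by blast
    have "compactin X (K - U)"
      using closed_compactin[OF assms(2) Diff_subset]
        closedin_diff[OF compactin_imp_closedin[OF assms(1,2)] assms(3)[OF U(1)]] by blast
    moreover have "compactin X {p}" "disjnt {p} (K - U)" using p KX U by auto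
    ultimately obtain G H where GH: "openin X G" "openin X H" "p \<in> G" "K - U \<subseteq> H" "disjnt G H"
      using Hausdorff_space_compact_separation[OF assms(1), of "{p}" "K - U"] by auto
    have "x \<in> U" if "x \<in> K" "x \<in> X closure_of (G \<inter> U)" for x
    proof (rule ccontr)
      assume "x \<notin> U"
      then have "x \<in> H" using GH(4) \<open>x \<in> K\<close> by blast
      then show False
        using \<open>x \<in> X closure_of (G \<inter> U)\<close> GH(2,5) unfolding in_closure_of disjnt_iff by blast
    qed
    then have "openin X (G \<inter> U) \<and> p \<in> G \<inter> U \<and> U \<in> \<U> \<and> G \<inter> U \<subseteq> U
        \<and> K \<inter> X closure_of (G \<inter> U) \<subseteq> U"
      using U GH(1,3) openin_Int[OF GH(1) assms(3)[OF U(1)]] by blast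
    then show ?thesis by blast
  qed
  then obtain G U where GU: "\<And>p. p \<in> K \<Longrightarrow> openin X (G p) \<and> p \<in> G p \<and> U p \<in> \<U> \<and> G p \<subseteq> U p
      \<and> K \<inter> X closure_of (G p) \<subseteq> U p"
    by metis
  obtain T where T: "finite T" "T \<subseteq> K" "K \<subseteq> \<Union>(G ` T)"
  proof -
    have "\<forall>W\<in>G ` K. openin X W" "K \<subseteq> \<Union>(G ` K)" using GU by auto
    then obtain \<F> where "finite \<F>" "\<F> \<subseteq> G ` K" "K \<subseteq> \<Union>\<F>"
      using assms(2) unfolding compactin_def by meson
    then show ?thesis
      using that by (metis finite_subset_image)
  qed
  define S where "S z = topspace X - \<Union>{X closure_of (G p) |p. p \<in> T \<and> z \<notin> U p}" for z
  have openS: "openin X (S z)" for z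
    unfolding S_def using T(1) by (intro openin_diff closedin_Union) auto
  have zS: "z \<in> S z" if "z \<in> K" for z
    using that KX GU T(2) by (auto simp: S_def)
  define N where "N = (\<Union>z\<in>K. S z) \<inter> \<Union>(G ` T)"
  have "openin X N"
    unfolding N_def using openS GU T(2) by (intro openin_Int openin_Union) auto
  moreover have "K \<subseteq> N" using zS T(3) by (auto simp: N_def)
  moreover
  define f where "f x = (SOME z. z \<in> K \<and> x \<in> S z)" for x
  have f: "f x \<in> K" "x \<in> S (f x)" if "x \<in> N" for x
    using someI_ex[of "\<lambda>z. z \<in> K \<and> x \<in> S z"] that by (auto simp: N_def f_def)
  have "f ` N \<subseteq> K" using f(1) by blast
  moreover have "\<exists>V W. openin X V \<and> x \<in> V \<and> V \<subseteq> N \<and> W \<in> \<U> \<and> V \<union> f ` V \<subseteq> W"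
    if x: "x \<in> N" for x
  proof -
    obtain p where p: "p \<in> T" "x \<in> G p" using x by (auto simp: N_def)
    have pK: "p \<in> K" using p T(2) by auto
    have "f y \<in> U p" if y: "y \<in> N" "y \<in> G p" for y
    proof (rule ccontr)
      assume "f y \<notin> U p"
      then have "y \<notin> X closure_of (G p)" using f(2)[OF y(1)] p(1) by (auto simp: S_def)
      then show False
        using y(2) closure_of_subset[OF openin_subset[of X "G p"]] GU[OF pK] by blast
    qed
    then have "(N \<inter> G p) \<union> f ` (N \<inter> G p) \<subseteq> U p"
      using GU[OF pK] by blast
    moreover have "openin X (N \<inter> G p)"
      using \<open>openin X N\<close> GU[OF pK] by blast
    ultimately show ?thesis using GU[OF pK] x p(2) by blast
  qed
  ultimately show ?thesis by (intro that) blast+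
qed

section \<open>Making a relative cochain vanish near a compact set\<close>

text \<open>With \<open>f\<close> adapted to a cover on whose members \<open>\<delta> \<phi>\<close> vanishes and on whose traces on
  \<open>K\<close> the function \<open>\<phi>\<close> vanishes, the homotopy formula reads \<open>\<phi> = \<delta> \<eta>\<close> on small tuples, where
  \<open>- \<eta>\<close> is the prism of \<open>\<phi>\<close>. Small tuples become arbitrary tuples of \<open>N\<close> at the price of the
  correction \<open>\<nu>\<close>.\<close>

lemma rel_cochain_vanishing_near_compact:
  fixes \<phi> :: "'a list \<Rightarrow> 'k::comm_ring_1"
  assumes "regular_space X" "Hausdorff_space X" "compactin X K"
    and \<phi>: "loc_zero (Suc m) X K \<phi>"
    and M: "openin X M" "K \<subseteq> M" "loc_zero (Suc (Suc m)) X M (delta \<phi>)"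
  obtains \<eta> \<nu> N where "loc_zero m X K \<eta>" "loc_zero (Suc m) X UNIV \<nu>"
    "openin X N" "K \<subseteq> N" "\<And>xs. xs \<in> tups (Suc m) N \<Longrightarrow> \<phi> xs = delta \<eta> xs + \<nu> xs"
proof -
  have KX: "K \<subseteq> topspace X" using assms(3) compactin_subset_topspace by blast
  define \<U> where "\<U> = {U. openin X U \<and> (\<forall>xs\<in>tups (Suc m) (U \<inter> K). \<phi> xs = 0) \<and>
      (\<forall>xs\<in>tups (Suc (Suc m)) U. delta \<phi> xs = 0)}"
  have cover: "K \<subseteq> \<Union>\<U>"
  proof
    fix p assume p: "p \<in> K"
    obtain U where U: "openin X U" "p \<in> U" "\<And>xs. xs \<in> tups (Suc m) (U \<inter> K) \<Longrightarrow> \<phi> xs = 0"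
      using loc_zeroD[OF \<phi>, of p] p KX by blast
    obtain V where V: "openin X V" "p \<in> V"
        "\<And>xs. xs \<in> tups (Suc (Suc m)) (V \<inter> M) \<Longrightarrow> delta \<phi> xs = 0"
      using loc_zeroD[OF M(3), of p] p KX M(2) by blast
    have "U \<inter> V \<inter> M \<in> \<U>"
      using U V M(1) by (auto simp: \<U>_def tups_def)
    then show "p \<in> \<Union>\<U>" using U V M(2) p by blast
  qed
  have opn: "openin X U" if "U \<in> \<U>" for U using that by (simp add: \<U>_def)
  obtain N0 f where N0: "openin X N0" "K \<subseteq> N0" "f ` N0 \<subseteq> K"
      "\<forall>x\<in>N0. \<exists>V U. openin X V \<and> x \<in> V \<and> V \<subseteq> N0 \<and> U \<in> \<U> \<and> V \<union> f ` V \<subseteq> U"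
    by (rule small_map_into_compact[OF assms(2,3) opn cover])
  define \<eta> where "\<eta> xs = (if set xs \<subseteq> N0 then - prism f \<phi> xs else 0)" for xs
  have \<eta>: "loc_zero m X K \<eta>"
  proof (rule loc_zeroI)
    fix p assume "p \<in> K"
    from bspec[OF N0(4) subsetD[OF N0(2) this]]
    obtain V U where VU: "openin X V" "p \<in> V" "V \<subseteq> N0" "U \<in> \<U>" "V \<union> f ` V \<subseteq> U"
      by (elim exE conjE)
    have "\<eta> xs = 0" if xs: "xs \<in> tups m (V \<inter> K)" for xs
    proof -
      have "prism f \<phi> xs = 0"
      proof (rule prism_eq_0)
        fix ys assume ys: "length ys = Suc (length xs)" "set ys \<subseteq> set xs \<union> f ` set xs"
        have "set xs \<subseteq> V" "set xs \<subseteq> K" using xs by (auto simp: tups_def)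
        moreover from this(1) VU(3) N0(3) have "f ` set xs \<subseteq> f ` V" "f ` set xs \<subseteq> K" by blast+
        ultimately have "set xs \<union> f ` set xs \<subseteq> U \<inter> K" using VU(5) by blast
        with ys(2) have "set ys \<subseteq> U \<inter> K" by (rule subset_trans)
        then have "ys \<in> tups (Suc m) (U \<inter> K)"
          using ys(1) xs by (simp add: tups_def)
        then show "\<phi> ys = 0" using VU(4) by (auto simp: \<U>_def)
      qed
      then show ?thesis by (simp add: \<eta>_def)
    qed
    then show "\<exists>V. openin X V \<and> p \<in> V \<and> (\<forall>xs\<in>tups m (V \<inter> K). \<eta> xs = 0)"
      using VU by blast
  qed
  have near: "loc_zero (Suc m) X N0 (\<lambda>xs. \<phi> xs - delta \<eta> xs)"
  proof (rule loc_zeroI)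
    fix p assume "p \<in> N0"
    from bspec[OF N0(4) this]
    obtain V U where VU: "openin X V" "p \<in> V" "V \<subseteq> N0" "U \<in> \<U>" "V \<union> f ` V \<subseteq> U"
      by (elim exE conjE)
    have "\<phi> xs - delta \<eta> xs = 0" if xs: "xs \<in> tups (Suc m) (V \<inter> N0)" for xs
    proof -
      have "prism f (delta \<phi>) xs = 0"
      proof (rule prism_eq_0)
        fix ys assume ys: "length ys = Suc (length xs)" "set ys \<subseteq> set xs \<union> f ` set xs"
        have "set xs \<subseteq> V" using xs by (auto simp: tups_def)
        then have "set xs \<union> f ` set xs \<subseteq> U" using VU(5) by blast
        with ys(2) have "set ys \<subseteq> U" by (rule subset_trans)
        then have "ys \<in> tups (Suc (Suc m)) U" using ys(1) xs by (simp add: tups_def)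
        then show "delta \<phi> ys = 0" using VU(4) by (auto simp: \<U>_def)
      qed
      moreover have "set xs \<subseteq> V" "length xs = Suc m" using xs by (auto simp: tups_def)
      then have "f ` set xs \<subseteq> U \<inter> K" "length xs = Suc m" using VU(3,5) N0(3) by blast+
      then have "map f xs \<in> tups (Suc m) (U \<inter> K)" by (simp add: tups_def)
      then have "\<phi> (map f xs) = 0" using VU(4) by (auto simp: \<U>_def)
      moreover have "delta \<eta> xs = delta (\<lambda>ys. (-1) * prism f \<phi> ys) xs"
        by (rule delta_cong) (use xs in \<open>auto simp: \<eta>_def tups_def\<close>)
      moreover have "delta (prism f \<phi>) xs + prism f (delta \<phi>) xs = \<phi> (map f xs) - \<phi> xs"
        by (rule prism_homotopy)
      ultimately show ?thesis by (simp only: delta_smult) simp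
    qed
    then show "\<exists>V. openin X V \<and> p \<in> V \<and>
        (\<forall>xs\<in>tups (Suc m) (V \<inter> N0). \<phi> xs - delta \<eta> xs = 0)"
      using VU by blast
  qed
  \<comment> \<open>The correction vanishes locally at the points of \<open>N0\<close> by the choice of \<open>\<eta>\<close>, and at the other
      points because these lie outside the closure of \<open>N\<close>.\<close>
  obtain N where N: "openin X N" "K \<subseteq> N" "X closure_of N \<subseteq> N0"
    using shrink_neighbourhood_of_compact[OF assms(1,3) N0(1,2)] by metis
  define \<nu> where "\<nu> xs = (if set xs \<subseteq> N then \<phi> xs - delta \<eta> xs else 0)" for xs
  have "loc_zero (Suc m) X UNIV \<nu>"
  proof (rule loc_zeroI)
    fix p assume p: "p \<in> topspace X"
    show "\<exists>V. openin X V \<and> p \<in> V \<and> (\<forall>xs\<in>tups (Suc m) (V \<inter> UNIV). \<nu> xs = 0)"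
    proof (cases "p \<in> N0")
      case True
      obtain V where V: "openin X V" "p \<in> V"
          "\<And>xs. xs \<in> tups (Suc m) (V \<inter> N0) \<Longrightarrow> \<phi> xs - delta \<eta> xs = 0"
        using loc_zeroD[OF near p True] by blast
      have "\<nu> xs = 0" if "xs \<in> tups (Suc m) (V \<inter> N0)" for xs
        using V(3)[OF that] by (auto simp: \<nu>_def)
      then show ?thesis
        using V True N0(1) by (intro exI[of _ "V \<inter> N0"]) auto
    next
      case False
      have "\<nu> xs = 0" if "xs \<in> tups (Suc m) (topspace X - X closure_of N)" for xs
      proof -
        from that obtain x where "x \<in> set xs" "x \<notin> N"
          using closure_of_subset[OF openin_subset[OF N(1)]]
          by (cases xs) (auto simp: tups_def)
        then show ?thesis by (auto simp: \<nu>_def)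
      qed
      then show ?thesis
        using p False N(3) by (intro exI[of _ "topspace X - X closure_of N"]) auto
    qed
  qed
  moreover have "\<phi> xs = delta \<eta> xs + \<nu> xs" if "xs \<in> tups (Suc m) N" for xs
    using that by (simp add: \<nu>_def tups_def)
  ultimately show ?thesis using that \<eta> N(1,2) by blast
qed

section \<open>Dynamics near an attractor\<close>

lemma attractor_invariant_neighbourhood:
  assumes "asymptotically_stable_attractor X g K" "openin X N" "K \<subseteq> N"
  obtains P U where "openin X U" "K \<subseteq> U" "U \<subseteq> P" "P \<subseteq> N" "g ` P \<subseteq> P"
proof -
  have "neighbourhood_of X K N"
    using assms(2,3) openin_subset unfolding neighbourhood_of_def by blast
  then obtain P where P: "neighbourhood_of X K P" "P \<subseteq> N" "g ` P \<subseteq> P"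
    using assms(1) unfolding asymptotically_stable_attractor_def by blast
  moreover obtain U where "openin X U" "K \<subseteq> U" "U \<subseteq> P"
    using P(1) unfolding neighbourhood_of_def by blast
  ultimately show ?thesis using that by blast
qed

lemma attractor_subset_topspace:
  "asymptotically_stable_attractor X g K \<Longrightarrow> K \<subseteq> topspace X"
  using compactin_subset_topspace unfolding asymptotically_stable_attractor_def by blast

text \<open>If \<open>g\<close> moved a point \<open>x\<close> of \<open>K\<close> out of \<open>K\<close>, then the complement of \<open>g x\<close> would be a
  neighbourhood of \<open>K\<close> that contains no positively invariant one.\<close>

lemma attractor_invariant:
  assumes "asymptotically_stable_attractor X g K" "Hausdorff_space X" "continuous_map X X g"
  shows "g ` K \<subseteq> K"
proof (rule ccontr)
  assume "\<not> g ` K \<subseteq> K"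
  then obtain x where x: "x \<in> K" "g x \<notin> K" by blast
  have KX: "K \<subseteq> topspace X" by (rule attractor_subset_topspace[OF assms(1)])
  have "g x \<in> topspace X" using x KX assms(3) continuous_map_funspace by blast
  then have "closedin X {g x}"
    using assms(2) by (simp add: closedin_Hausdorff_singleton)
  then have "openin X (topspace X - {g x})" by blast
  moreover have "K \<subseteq> topspace X - {g x}" using KX x by auto
  ultimately obtain P U where "openin X U" "K \<subseteq> U" "U \<subseteq> P" "P \<subseteq> topspace X - {g x}" "g ` P \<subseteq> P"
    by (rule attractor_invariant_neighbourhood[OF assms(1)])
  then show False using x(1) by blast
qed

lemma attractor_nonempty:
  assumes "asymptotically_stable_attractor X g K" "topspace X \<noteq> {}"
  shows "K \<noteq> {}"
proof
  assume "K = {}"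
  then have "neighbourhood_of X K {}" by (simp add: neighbourhood_of_def)
  then show False
    using assms unfolding asymptotically_stable_attractor_def by blast
qed

lemma funpow_image_subset: "g ` P \<subseteq> P \<Longrightarrow> (g ^^ n) ` P \<subseteq> P"
  by (induction n) auto

lemma continuous_map_funpow: "continuous_map X X g \<Longrightarrow> continuous_map X X (g ^^ n)"
  by (induction n) (auto simp: funpow_Suc_right intro: continuous_map_compose simp del: funpow.simps(2))

text \<open>Once an orbit has entered the positively invariant set \<open>P\<close> it stays there. Entering the
  open set \<open>U\<close> at a fixed time is an open condition on the starting point, so one time bound serves a
  whole neighbourhood.\<close>

lemma attractor_uniformly_locally:
  assumes "asymptotically_stable_attractor X g K" "continuous_map X X g"
    and "openin X U" "K \<subseteq> U" "U \<subseteq> P" "g ` P \<subseteq> P" "x \<in> topspace X"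
  obtains V k where "openin X V" "x \<in> V" "\<And>y n. y \<in> V \<Longrightarrow> k \<le> n \<Longrightarrow> (g ^^ n) y \<in> P"
proof -
  have "neighbourhood_of X K U"
    using assms(3,4) openin_subset unfolding neighbourhood_of_def by blast
  then obtain k where k: "(g ^^ k) x \<in> U"
    using assms(1,7) unfolding asymptotically_stable_attractor_def by blast
  show ?thesis
  proof
    show "openin X {y \<in> topspace X. (g ^^ k) y \<in> U}"
      by (rule openin_continuous_map_preimage[OF continuous_map_funpow[OF assms(2)] assms(3)])
    show "x \<in> {y \<in> topspace X. (g ^^ k) y \<in> U}" using k assms(7) by simp
    fix y n assume y: "y \<in> {y \<in> topspace X. (g ^^ k) y \<in> U}" and "k \<le> n"
    then have "(g ^^ n) y = (g ^^ (n - k)) ((g ^^ k) y)"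
      by (metis comp_apply funpow_add le_add_diff_inverse2)
    then show "(g ^^ n) y \<in> P"
      using y assms(5) funpow_image_subset[OF assms(6), of "n - k"] by auto
  qed
qed

section \<open>Eigencochains are coboundaries\<close>

text \<open>The telescoping argument. Each tuple has finitely many entries, each of which ends up in
  \<open>P\<close>; hence \<open>Sum_any\<close> is a finite sum at each tuple, and on a neighbourhood of each
  point it is a fixed finite sum.\<close>

lemma eigencochain_vanishing_near_attractor:
  fixes \<mu> :: "'k::field" and \<phi> \<beta> :: "'a list \<Rightarrow> 'k"
  assumes att: "asymptotically_stable_attractor X g K" and cont: "continuous_map X X g"
    and P: "openin X U" "K \<subseteq> U" "U \<subseteq> P" "g ` P \<subseteq> P"
    and \<mu>: "\<mu> \<noteq> 0"
    and \<phi>P: "\<And>xs. xs \<in> tups (Suc m) P \<Longrightarrow> \<phi> xs = 0"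
    and \<beta>P: "\<And>xs. xs \<in> tups m P \<Longrightarrow> \<beta> xs = 0"
    and eig: "loc_zero (Suc m) X UNIV (\<lambda>xs. \<phi> (map g xs) - \<mu> * \<phi> xs - delta \<beta> xs)"
  obtains \<gamma> where "\<And>xs. xs \<in> tups m P \<Longrightarrow> \<gamma> xs = 0"
    "loc_zero (Suc m) X UNIV (\<lambda>xs. \<phi> xs - delta \<gamma> xs)"
proof -
  define c where "c = inverse \<mu>"
  have c\<mu>: "c * \<mu> = 1" using \<mu> by (simp add: c_def)
  define \<gamma> where "\<gamma> xs = - Sum_any (\<lambda>n. c ^ Suc n * \<beta> (map (g ^^ n) xs))" for xs
  define \<nu> where "\<nu> xs = \<phi> (map g xs) - \<mu> * \<phi> xs - delta \<beta> xs" for xs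
  have \<nu>: "loc_zero (Suc m) X UNIV \<nu>"
    using eig by (simp add: \<nu>_def[abs_def])
  have iterP: "map (g ^^ n) xs \<in> tups l P" if "xs \<in> tups l P" for xs l n
    using that funpow_image_subset[OF P(4), of n] by (fastforce simp: tups_def)
  have "\<gamma> xs = 0" if "xs \<in> tups m P" for xs
    using \<beta>P[OF iterP[OF that]] by (simp add: \<gamma>_def)
  moreover have "loc_zero (Suc m) X UNIV (\<lambda>xs. \<phi> xs - delta \<gamma> xs)"
  proof (rule loc_zeroI)
    fix x assume x: "x \<in> topspace X"
    obtain V k where V: "openin X V" "x \<in> V" "\<And>y n. y \<in> V \<Longrightarrow> k \<le> n \<Longrightarrow> (g ^^ n) y \<in> P"
      using attractor_uniformly_locally[OF att cont P x] by metis
    have in_P: "map (g ^^ n) ys \<in> tups l P" if "ys \<in> tups l V" "k \<le> n" for ys l n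
      using that V(3) by (fastforce simp: tups_def)
    have \<gamma>V: "\<gamma> ys = (\<Sum>n<k. - (c ^ Suc n) * \<beta> (map (g ^^ n) ys))" if "ys \<in> tups m V" for ys
    proof -
      have "{n. c ^ Suc n * \<beta> (map (g ^^ n) ys) \<noteq> 0} \<subseteq> {..<k}"
        using \<beta>P[OF in_P[OF that]] by (auto simp: not_less intro!: leI)
      then have "Sum_any (\<lambda>n. c ^ Suc n * \<beta> (map (g ^^ n) ys))
          = (\<Sum>n<k. c ^ Suc n * \<beta> (map (g ^^ n) ys))"
        by (intro Sum_any.expand_superset) auto
      then show ?thesis by (simp add: \<gamma>_def sum_negf)
    qed
    have tel: "\<phi> xs - delta \<gamma> xs = (\<Sum>n<k. - (c ^ Suc n) * \<nu> (map (g ^^ n) xs))"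
      if xs: "xs \<in> tups (Suc m) V" for xs
    proof -
      have "delta \<gamma> xs = delta (\<lambda>ys. \<Sum>n<k. - (c ^ Suc n) * \<beta> (map (g ^^ n) ys)) xs"
        by (rule delta_cong, rule \<gamma>V) (use xs in \<open>auto simp: tups_def\<close>)
      also have "\<dots> = (\<Sum>n<k. - (c ^ Suc n) * delta \<beta> (map (g ^^ n) xs))"
        by (simp only: delta_sum delta_smult delta_map)
      finally have d\<gamma>: "delta \<gamma> xs = (\<Sum>n<k. - (c ^ Suc n) * delta \<beta> (map (g ^^ n) xs))" .
      \<comment> \<open>The function that telescopes: \<open>c (\<phi> (g\<^sup>n\<^sup>+\<^sup>1 xs) - \<mu> \<phi> (g\<^sup>n xs))\<close>, scaled by \<open>c\<^sup>n\<close>, is a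
          difference of consecutive values.\<close>
      define t where "t n = c ^ n * \<phi> (map (g ^^ n) xs)" for n
      have step: "- (c ^ Suc n) * \<nu> (map (g ^^ n) xs) + - (c ^ Suc n) * delta \<beta> (map (g ^^ n) xs)
          = - (t (Suc n) - t n)" for n
      proof -
        have "map g (map (g ^^ n) xs) = map (g ^^ Suc n) xs" by simp
        then have "- (c ^ Suc n) * \<nu> (map (g ^^ n) xs) + - (c ^ Suc n) * delta \<beta> (map (g ^^ n) xs)
            = - (c ^ Suc n * \<phi> (map (g ^^ Suc n) xs)) + c ^ n * (c * \<mu>) * \<phi> (map (g ^^ n) xs)"
          unfolding \<nu>_def by (simp add: algebra_simps)
        then show ?thesis by (simp add: c\<mu> t_def)
      qed
      have "t k = 0" using \<phi>P[OF in_P[OF xs]] by (simp add: t_def)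
      moreover have "(\<Sum>n<k. t (Suc n) - t n) = t k - t 0"
        by (rule sum_lessThan_telescope)
      ultimately have "(\<Sum>n<k. - (c ^ Suc n) * \<nu> (map (g ^^ n) xs)) + delta \<gamma> xs = t 0"
        unfolding d\<gamma> sum.distrib[symmetric] step sum_negf by simp
      then show ?thesis by (simp add: t_def algebra_simps)
    qed
    have "loc_zero (Suc m) X UNIV (\<lambda>xs. \<Sum>n<k. - (c ^ Suc n) * \<nu> (map (g ^^ n) xs))"
      by (intro loc_zero_sum loc_zero_smult loc_zero_pullback \<nu> continuous_map_funpow cont) auto
    from loc_zeroD[OF this x UNIV_I] obtain W where W: "openin X W" "x \<in> W"
        "\<And>xs. xs \<in> tups (Suc m) (W \<inter> UNIV) \<Longrightarrow> (\<Sum>n<k. - (c ^ Suc n) * \<nu> (map (g ^^ n) xs)) = 0"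
      by blast
    have "\<phi> xs - delta \<gamma> xs = 0" if "xs \<in> tups (Suc m) (V \<inter> W)" for xs
      using tel[of xs] W(3)[of xs] that by (auto simp: tups_def)
    then show "\<exists>U. openin X U \<and> x \<in> U \<and> (\<forall>xs\<in>tups (Suc m) (U \<inter> UNIV). \<phi> xs - delta \<gamma> xs = 0)"
      using V W by (intro exI[of _ "V \<inter> W"]) auto
  qed
  ultimately show ?thesis using that by blast
qed

text \<open>Replacing \<open>\<phi>\<close> by \<open>\<phi> - \<delta> \<eta> - \<nu>\<close> turns \<open>\<beta>\<close> into \<open>\<beta> - g\<^sup>* \<eta> + \<mu> \<eta>\<close>. Replacing the latter by
  its difference with \<open>\<delta> \<eta>' + \<nu>'\<close> changes its coboundary only by the locally zero \<open>\<delta> \<nu>'\<close>. After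
  both corrections the telescoping argument applies.\<close>

lemma eigencocycle_is_coboundary:
  fixes \<mu> :: "'k::field" and \<phi> \<beta> :: "'a list \<Rightarrow> 'k"
  assumes reg: "regular_space X" and hd: "Hausdorff_space X"
    and att: "asymptotically_stable_attractor X g K" and cont: "continuous_map X X g"
    and ne: "K \<noteq> {}" and \<mu>: "\<mu> \<noteq> 0"
    and \<phi>: "loc_zero (Suc m) X K \<phi>" and d\<phi>: "loc_zero (Suc (Suc m)) X UNIV (delta \<phi>)"
    and \<beta>: "loc_zero m X K \<beta>"
    and eig: "loc_zero (Suc m) X UNIV (\<lambda>xs. \<phi> (map g xs) - \<mu> * \<phi> xs - delta \<beta> xs)"
  obtains \<gamma> where "loc_zero m X K \<gamma>" "loc_zero (Suc m) X UNIV (\<lambda>xs. \<phi> xs - delta \<gamma> xs)"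
proof -
  have cpt: "compactin X K" using att by (simp add: asymptotically_stable_attractor_def)
  have KX: "K \<subseteq> topspace X" by (rule attractor_subset_topspace[OF att])
  have gK: "g ` (topspace X \<inter> K) \<subseteq> K" using attractor_invariant[OF att hd cont] by blast
  obtain \<eta> \<nu> N where \<eta>: "loc_zero m X K \<eta>" and \<nu>: "loc_zero (Suc m) X UNIV \<nu>"
      and N: "openin X N" "K \<subseteq> N" "\<And>xs. xs \<in> tups (Suc m) N \<Longrightarrow> \<phi> xs = delta \<eta> xs + \<nu> xs"
    using rel_cochain_vanishing_near_compact[OF reg hd cpt \<phi> openin_topspace KX]
      loc_zero_mono[OF d\<phi> subset_UNIV] by metis
  define \<phi>' where "\<phi>' xs = \<phi> xs - delta \<eta> xs - \<nu> xs" for xs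
  define \<beta>' where "\<beta>' xs = \<beta> xs - \<eta> (map g xs) + \<mu> * \<eta> xs" for xs
  define \<rho> where "\<rho> xs = \<phi>' (map g xs) - \<mu> * \<phi>' xs - delta \<beta>' xs" for xs
  have \<beta>'K: "loc_zero m X K \<beta>'"
    unfolding \<beta>'_def[abs_def]
    by (intro loc_zero_add loc_zero_diff loc_zero_smult \<beta> \<eta> loc_zero_pullback cont gK)
  \<comment> \<open>The terms with \<open>\<eta>\<close> cancel, since the coboundary commutes with pullback along \<open>g\<close>.\<close>
  have "loc_zero (Suc m) X UNIV
      (\<lambda>xs. (\<phi> (map g xs) - \<mu> * \<phi> xs - delta \<beta> xs) - \<nu> (map g xs) + \<mu> * \<nu> xs)"
    by (intro loc_zero_add loc_zero_diff loc_zero_smult eig \<nu> loc_zero_pullback cont) auto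
  then have \<rho>: "loc_zero (Suc m) X UNIV \<rho>"
    by (rule loc_zero_cong)
      (simp add: \<rho>_def \<phi>'_def \<beta>'_def[abs_def] delta_add delta_diff delta_smult delta_map algebra_simps)
  have \<phi>'N: "\<phi>' xs = 0" if "xs \<in> tups (Suc m) N" for xs
    using N(3)[OF that] by (simp add: \<phi>'_def)
  have "\<exists>\<beta>'' N'. openin X N' \<and> K \<subseteq> N' \<and> (\<forall>xs\<in>tups m N'. \<beta>'' xs = 0) \<and>
      loc_zero (Suc m) X UNIV (\<lambda>xs. delta \<beta>' xs - delta \<beta>'' xs)"
  proof (cases m)
    case 0
    \<comment> \<open>On empty tuples, vanishing near one point of \<open>K\<close> already means vanishing.\<close>
    obtain p where p: "p \<in> K" using ne by blast
    obtain V where V: "p \<in> V" "\<And>xs. xs \<in> tups m (V \<inter> K) \<Longrightarrow> \<beta>' xs = 0"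
      using loc_zeroD[OF \<beta>'K, of p] p KX by blast
    have "\<beta>' [] = 0" by (rule V(2)) (simp add: 0 tups_def)
    then show ?thesis
      by (intro exI[of _ \<beta>'] exI[of _ "topspace X"]) (auto simp: 0 KX tups_def)
  next
    case (Suc l)
    obtain Q U where Q: "openin X U" "K \<subseteq> U" "U \<subseteq> Q" "Q \<subseteq> N" "g ` Q \<subseteq> Q"
      using attractor_invariant_neighbourhood[OF att N(1,2)] by metis
    have "loc_zero (Suc m) X U (\<lambda>xs. (-1) * \<rho> xs)"
      by (intro loc_zero_smult loc_zero_mono[OF \<rho>] subset_UNIV)
    then have "loc_zero (Suc m) X U (delta \<beta>')"
    proof (rule loc_zero_cong)
      fix xs assume "xs \<in> tups (Suc m) (topspace X \<inter> U)"
      then have "xs \<in> tups (Suc m) N" "map g xs \<in> tups (Suc m) N"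
        using Q by (fastforce simp: tups_def)+
      then show "delta \<beta>' xs = (-1) * \<rho> xs" by (simp add: \<rho>_def \<phi>'N)
    qed
    then obtain \<eta>' \<nu>' N' where \<nu>': "loc_zero m X UNIV \<nu>'" and N': "openin X N'" "K \<subseteq> N'"
        "\<And>xs. xs \<in> tups m N' \<Longrightarrow> \<beta>' xs = delta \<eta>' xs + \<nu>' xs"
      using rel_cochain_vanishing_near_compact[OF reg hd cpt \<beta>'K[unfolded Suc] Q(1,2)]
      unfolding Suc by metis
    define \<beta>'' where "\<beta>'' xs = \<beta>' xs - delta \<eta>' xs - \<nu>' xs" for xs
    have "loc_zero (Suc m) X UNIV (\<lambda>xs. delta \<beta>' xs - delta \<beta>'' xs)"
      by (rule loc_zero_cong[OF loc_zero_delta[OF \<nu>']])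
        (simp add: \<beta>''_def[abs_def] delta_diff delta_delta)
    then show ?thesis
      using N' by (intro exI[of _ \<beta>''] exI[of _ N']) (auto simp: \<beta>''_def)
  qed
  then obtain \<beta>'' N' where N': "openin X N'" "K \<subseteq> N'" "\<And>xs. xs \<in> tups m N' \<Longrightarrow> \<beta>'' xs = 0"
      and \<beta>'': "loc_zero (Suc m) X UNIV (\<lambda>xs. delta \<beta>' xs - delta \<beta>'' xs)"
    by blast
  obtain P U where P: "openin X U" "K \<subseteq> U" "U \<subseteq> P" "g ` P \<subseteq> P" and PN: "P \<subseteq> N \<inter> N'"
    using attractor_invariant_neighbourhood[OF att openin_Int[OF N(1) N'(1)]] N(2) N'(2)
    by (metis Int_greatest)
  have eig'': "loc_zero (Suc m) X UNIV (\<lambda>xs. \<phi>' (map g xs) - \<mu> * \<phi>' xs - delta \<beta>'' xs)"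
    by (rule loc_zero_cong[OF loc_zero_add[OF \<rho> \<beta>'']]) (simp add: \<rho>_def)
  have "\<phi>' xs = 0" if "xs \<in> tups (Suc m) P" for xs
    using \<phi>'N tups_mono[OF _ that] PN by blast
  moreover have "\<beta>'' xs = 0" if "xs \<in> tups m P" for xs
    using N'(3) tups_mono[OF _ that] PN by blast
  ultimately obtain \<gamma> where \<gamma>: "\<And>xs. xs \<in> tups m P \<Longrightarrow> \<gamma> xs = 0"
      "loc_zero (Suc m) X UNIV (\<lambda>xs. \<phi>' xs - delta \<gamma> xs)"
    using eigencochain_vanishing_near_attractor[OF att cont P \<mu> _ _ eig''] by metis
  have "loc_zero m X K \<gamma>"
  proof (rule loc_zeroI)
    fix x assume "x \<in> K"
    moreover have "\<gamma> xs = 0" if "xs \<in> tups m (U \<inter> K)" for xs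
      using \<gamma>(1) tups_mono[OF _ that] P(3) by blast
    ultimately show "\<exists>U. openin X U \<and> x \<in> U \<and> (\<forall>xs\<in>tups m (U \<inter> K). \<gamma> xs = 0)"
      using P by blast
  qed
  then have "loc_zero m X K (\<lambda>xs. \<gamma> xs + \<eta> xs)"
    using \<eta> by (rule loc_zero_add)
  moreover have "loc_zero (Suc m) X UNIV (\<lambda>xs. \<phi> xs - delta (\<lambda>ys. \<gamma> ys + \<eta> ys) xs)"
    by (rule loc_zero_cong[OF loc_zero_add[OF \<gamma>(2) \<nu>]]) (simp add: \<phi>'_def delta_add)
  ultimately show ?thesis using that by blast
qed

section \<open>Cohomology classes in terms of cochains\<close>

lemma coboundary_eq_delta:
  "coboundary q X \<phi> = (\<lambda>xs. if xs \<in> tups (Suc (Suc q)) (topspace X) then delta \<phi> xs else 0)"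
proof
  fix xs
  have "(\<Sum>i\<le>Suc q. (-1) ^ i * \<phi> (take i xs @ drop (Suc i) xs)) = delta \<phi> xs"
    if "length xs = Suc (Suc q)"
    by (simp add: delta_eq_sum that lessThan_Suc_atMost del: sum.atMost_Suc)
  then show "coboundary q X \<phi> xs = (if xs \<in> tups (Suc (Suc q)) (topspace X) then delta \<phi> xs else 0)"
    by (auto simp: coboundary_def tuples_eq_tups) (auto simp: tups_def)
qed

lemma null_cochains_iff:
  "\<phi> \<in> null_cochains q X \<longleftrightarrow> \<phi> \<in> cochains q X \<and> loc_zero (Suc q) X UNIV \<phi>"
  by (simp add: null_cochains_def locally_zero_absolute_iff)

lemma rel_cochains_iff:
  "\<phi> \<in> carrier (rel_cochains q X A) \<longleftrightarrow> \<phi> \<in> cochains q X \<and> loc_zero (Suc q) X A \<phi>"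
  by (simp add: rel_cochains_def locally_zero_iff)

lemma null_cochains_zero [simp]: "(\<lambda>xs. 0) \<in> null_cochains q X"
  by (simp add: null_cochains_iff cochains_def)

lemma null_cochains_add:
  "\<phi> \<in> null_cochains q X \<Longrightarrow> \<psi> \<in> null_cochains q X \<Longrightarrow> (\<lambda>xs. \<phi> xs + \<psi> xs) \<in> null_cochains q X"
  by (simp add: null_cochains_iff cochains_def loc_zero_add)

lemma null_cochains_smult:
  "\<phi> \<in> null_cochains q X \<Longrightarrow> (\<lambda>xs. c * \<phi> xs) \<in> null_cochains q X"
  by (simp add: null_cochains_iff cochains_def loc_zero_smult)

lemma null_cochains_diff:
  "\<phi> \<in> null_cochains q X \<Longrightarrow> \<psi> \<in> null_cochains q X \<Longrightarrow> (\<lambda>xs. \<phi> xs - \<psi> xs) \<in> null_cochains q X"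
  by (simp add: null_cochains_iff cochains_def loc_zero_diff)

lemma coboundary_diff:
  "(\<lambda>xs. coboundary q X \<phi> xs - coboundary q X \<psi> xs) = coboundary q X (\<lambda>xs. \<phi> xs - \<psi> xs)"
  by (auto simp: coboundary_eq_delta delta_diff)

lemma null_cochains_coboundary:
  assumes "\<phi> \<in> null_cochains q X"
  shows "coboundary q X \<phi> \<in> null_cochains (Suc q) X"
proof -
  have "loc_zero (Suc (Suc q)) X UNIV (delta \<phi>)"
    using assms by (simp add: null_cochains_iff loc_zero_delta)
  then have "loc_zero (Suc (Suc q)) X UNIV (coboundary q X \<phi>)"
    by (rule loc_zero_cong) (simp add: coboundary_eq_delta)
  then show ?thesis
    by (simp add: null_cochains_iff) (simp add: cochains_def coboundary_eq_delta tuples_eq_tups)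
qed

lemma null_cochains_pullback:
  assumes "\<phi> \<in> null_cochains q X" "continuous_map X X g"
  shows "pullback q X g \<phi> \<in> null_cochains q X"
proof -
  have "loc_zero (Suc q) X UNIV (\<lambda>xs. \<phi> (map g xs))"
    using assms by (intro loc_zero_pullback) (auto simp: null_cochains_iff)
  then have "loc_zero (Suc q) X UNIV (pullback q X g \<phi>)"
    by (rule loc_zero_cong) (simp add: pullback_def tuples_eq_tups)
  then show ?thesis
    by (simp add: null_cochains_iff) (simp add: cochains_def pullback_def)
qed

text \<open>The coset of a cochain modulo the null cochains. It is the same set for every subspace
  \<open>A\<close>, and is described by differences so that equality of classes is a membership statement.\<close>

definition AS_class :: "nat \<Rightarrow> 'a topology \<Rightarrow> ('a list \<Rightarrow> 'k::field) \<Rightarrow> ('a list \<Rightarrow> 'k) set" where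
  "AS_class q X \<phi> = {\<psi>. (\<lambda>xs. \<psi> xs - \<phi> xs) \<in> null_cochains q X}"

lemma AS_class_self: "\<phi> \<in> AS_class q X \<phi>"
  by (simp add: AS_class_def)

lemma AS_class_eq_iff:
  "AS_class q X \<phi> = AS_class q X \<psi> \<longleftrightarrow> (\<lambda>xs. \<phi> xs - \<psi> xs) \<in> null_cochains q X"
proof
  assume "AS_class q X \<phi> = AS_class q X \<psi>"
  then show "(\<lambda>xs. \<phi> xs - \<psi> xs) \<in> null_cochains q X"
    using AS_class_self[of \<phi> q X] by (simp add: AS_class_def)
next
  assume d: "(\<lambda>xs. \<phi> xs - \<psi> xs) \<in> null_cochains q X"
  have "(\<lambda>xs. \<theta> xs - \<phi> xs) \<in> null_cochains q X \<longleftrightarrow> (\<lambda>xs. \<theta> xs - \<psi> xs) \<in> null_cochains q X" for \<theta>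
    using null_cochains_add[OF _ d, of "\<lambda>xs. \<theta> xs - \<phi> xs"]
      null_cochains_diff[OF _ d, of "\<lambda>xs. \<theta> xs - \<psi> xs"] by auto
  then show "AS_class q X \<phi> = AS_class q X \<psi>" by (simp add: AS_class_def)
qed

lemma rel_cochains_coset:
  "null_cochains q X +>\<^bsub>rel_cochains q X A\<^esub> \<phi> = AS_class q X \<phi>"
proof -
  have "null_cochains q X +>\<^bsub>rel_cochains q X A\<^esub> \<phi>
      = (\<lambda>\<nu> xs. \<nu> xs + \<phi> xs) ` null_cochains q X"
    by (auto simp: a_r_coset_def' rel_cochains_def)
  also have "\<dots> = AS_class q X \<phi>"
  proof
    show "(\<lambda>\<nu> xs. \<nu> xs + \<phi> xs) ` null_cochains q X \<subseteq> AS_class q X \<phi>"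
      by (auto simp: AS_class_def)
    show "AS_class q X \<phi> \<subseteq> (\<lambda>\<nu> xs. \<nu> xs + \<phi> xs) ` null_cochains q X"
    proof
      fix \<psi> assume "\<psi> \<in> AS_class q X \<phi>"
      then have "(\<lambda>xs. \<psi> xs - \<phi> xs) \<in> null_cochains q X" by (simp add: AS_class_def)
      then show "\<psi> \<in> (\<lambda>\<nu> xs. \<nu> xs + \<phi> xs) ` null_cochains q X"
        by (rule rev_image_eqI) simp
    qed
  qed
  finally show ?thesis .
qed

lemma quotient_map_to_AS_class:
  assumes "\<And>\<psi>. \<psi> \<in> AS_class q X \<phi> \<Longrightarrow> (\<lambda>xs. F \<psi> xs - F \<phi> xs) \<in> null_cochains q' X"
  shows "quotient_map_to (rel_cochains q' X A) (null_cochains q' X) F (AS_class q X \<phi>)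
    = AS_class q' X (F \<phi>)"
proof -
  have "(\<Union>\<psi>\<in>AS_class q X \<phi>. AS_class q' X (F \<psi>)) = (\<Union>\<psi>\<in>AS_class q X \<phi>. AS_class q' X (F \<phi>))"
    by (rule SUP_cong[OF refl]) (simp add: AS_class_eq_iff assms)
  also have "\<dots> = AS_class q' X (F \<phi>)"
    using AS_class_self[of \<phi> q X] by blast
  finally show ?thesis
    by (simp add: quotient_map_to_def rel_cochains_coset)
qed

lemma AS_coboundary_class:
  "AS_coboundary q X A (AS_class q X \<phi>) = AS_class (Suc q) X (coboundary q X \<phi>)"
  unfolding AS_coboundary_def
  by (rule quotient_map_to_AS_class)
    (simp add: coboundary_diff AS_class_def null_cochains_coboundary)

lemma AS_pullback_class:
  assumes "continuous_map X X g"
  shows "AS_pullback q X A g (AS_class q X \<phi>) = AS_class q X (pullback q X g \<phi>)"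
  unfolding AS_pullback_def
proof (rule quotient_map_to_AS_class)
  fix \<psi> assume "\<psi> \<in> AS_class q X \<phi>"
  then have "pullback q X g (\<lambda>xs. \<psi> xs - \<phi> xs) \<in> null_cochains q X"
    by (simp add: AS_class_def null_cochains_pullback assms)
  moreover have "pullback q X g (\<lambda>xs. \<psi> xs - \<phi> xs)
      = (\<lambda>xs. pullback q X g \<psi> xs - pullback q X g \<phi> xs)"
    by (auto simp: pullback_def)
  ultimately show "(\<lambda>xs. pullback q X g \<psi> xs - pullback q X g \<phi> xs) \<in> null_cochains q X"
    by simp
qed

lemma AS_cochains_carrier:
  "carrier (AS_cochains q X A) = AS_class q X ` carrier (rel_cochains q X A)"
  by (auto simp: AS_cochains_def quotient_module_def A_RCOSETS_def' rel_cochains_coset)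

lemma AS_cochains_zero: "\<zero>\<^bsub>AS_cochains q X A\<^esub> = AS_class q X (\<lambda>xs. 0)"
  by (simp add: AS_cochains_def quotient_module_def AS_class_def)

lemma AS_cochains_add:
  "AS_class q X \<phi> \<oplus>\<^bsub>AS_cochains q X A\<^esub> AS_class q X \<psi> = AS_class q X (\<lambda>xs. \<phi> xs + \<psi> xs)"
proof
  have eq: "AS_class q X \<phi> \<oplus>\<^bsub>AS_cochains q X A\<^esub> AS_class q X \<psi>
      = {(\<lambda>xs. a xs + b xs) |a b. a \<in> AS_class q X \<phi> \<and> b \<in> AS_class q X \<psi>}"
    by (auto simp: AS_cochains_def quotient_module_def set_add_def' rel_cochains_def)
  show "AS_class q X \<phi> \<oplus>\<^bsub>AS_cochains q X A\<^esub> AS_class q X \<psi> \<subseteq> AS_class q X (\<lambda>xs. \<phi> xs + \<psi> xs)"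
    unfolding eq
  proof clarify
    fix a b assume "a \<in> AS_class q X \<phi>" "b \<in> AS_class q X \<psi>"
    then have "(\<lambda>xs. (a xs - \<phi> xs) + (b xs - \<psi> xs)) \<in> null_cochains q X"
      by (simp add: AS_class_def null_cochains_add)
    moreover have "(\<lambda>xs. (a xs - \<phi> xs) + (b xs - \<psi> xs)) = (\<lambda>xs. (a xs + b xs) - (\<phi> xs + \<psi> xs))"
      by (simp add: algebra_simps)
    ultimately show "(\<lambda>xs. a xs + b xs) \<in> AS_class q X (\<lambda>xs. \<phi> xs + \<psi> xs)"
      by (simp add: AS_class_def)
  qed
  show "AS_class q X (\<lambda>xs. \<phi> xs + \<psi> xs) \<subseteq> AS_class q X \<phi> \<oplus>\<^bsub>AS_cochains q X A\<^esub> AS_class q X \<psi>"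
    unfolding eq
  proof
    fix c assume "c \<in> AS_class q X (\<lambda>xs. \<phi> xs + \<psi> xs)"
    then have "(\<lambda>xs. c xs - \<psi> xs) \<in> AS_class q X \<phi>"
      by (simp add: AS_class_def algebra_simps)
    moreover have "c = (\<lambda>xs. (c xs - \<psi> xs) + \<psi> xs)" by simp
    ultimately show "c \<in> {(\<lambda>xs. a xs + b xs) |a b. a \<in> AS_class q X \<phi> \<and> b \<in> AS_class q X \<psi>}"
      using AS_class_self[of \<psi> q X]
      by (intro CollectI exI[of _ "\<lambda>xs. c xs - \<psi> xs", OF exI[of _ \<psi>]] conjI)
  qed
qed

lemma AS_cochains_smult:
  "c \<odot>\<^bsub>AS_cochains q X A\<^esub> AS_class q X \<phi> = AS_class q X (\<lambda>xs. c * \<phi> xs)"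
proof -
  have "c \<odot>\<^bsub>AS_cochains q X A\<^esub> AS_class q X \<phi>
      = quotient_map_to (rel_cochains q X A) (null_cochains q X) (\<lambda>\<phi> xs. c * \<phi> xs) (AS_class q X \<phi>)"
    by (simp add: AS_cochains_def quotient_module_def quotient_map_to_def rel_cochains_coset
        rel_cochains_def)
  also have "\<dots> = AS_class q X (\<lambda>xs. c * \<phi> xs)"
  proof (rule quotient_map_to_AS_class)
    fix \<psi> assume "\<psi> \<in> AS_class q X \<phi>"
    then have "(\<lambda>xs. c * (\<psi> xs - \<phi> xs)) \<in> null_cochains q X"
      by (simp add: AS_class_def null_cochains_smult)
    then show "(\<lambda>xs. c * \<psi> xs - c * \<phi> xs) \<in> null_cochains q X"
      by (simp add: right_diff_distrib)
  qed
  finally show ?thesis .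
qed

text \<open>Representatives of the classes in \<^const>\<open>AS_coboundaries\<close>.\<close>

definition rel_coboundaries :: "nat \<Rightarrow> 'a topology \<Rightarrow> 'a set \<Rightarrow> ('a list \<Rightarrow> 'k::field) set" where
  "rel_coboundaries q X A = (case q of
       0 \<Rightarrow> {\<lambda>xs. 0}
     | Suc p \<Rightarrow> coboundary p X ` carrier (rel_cochains p X A))"

lemma AS_coboundaries_eq: "AS_coboundaries q X A = AS_class q X ` rel_coboundaries q X A"
  by (cases q)
    (simp_all add: AS_coboundaries_def rel_coboundaries_def AS_cochains_zero AS_cochains_carrier
      image_image AS_coboundary_class)

lemma rel_coboundaries_zero: "(\<lambda>xs. 0) \<in> rel_coboundaries q X A"
proof (cases q)
  case (Suc p)
  have "coboundary p X (\<lambda>xs. 0) = (\<lambda>xs. 0)" by (auto simp: coboundary_eq_delta)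
  moreover have "(\<lambda>xs. 0) \<in> carrier (rel_cochains p X A)"
    by (simp add: rel_cochains_iff cochains_def)
  ultimately show ?thesis
    unfolding rel_coboundaries_def Suc nat.case by (intro image_eqI[OF sym])
qed (simp add: rel_coboundaries_def)

lemma rel_coboundaries_add_smult:
  assumes "\<phi> \<in> rel_coboundaries q X A" "\<psi> \<in> rel_coboundaries q X A"
  shows "(\<lambda>xs. \<phi> xs + c * \<psi> xs) \<in> rel_coboundaries q X A"
proof (cases q)
  case 0
  then show ?thesis using assms by (simp add: rel_coboundaries_def)
next
  case (Suc p)
  obtain a b where ab: "a \<in> carrier (rel_cochains p X A)" "b \<in> carrier (rel_cochains p X A)"
      "\<phi> = coboundary p X a" "\<psi> = coboundary p X b"
    using assms by (auto simp: rel_coboundaries_def Suc)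
  have "(\<lambda>xs. a xs + c * b xs) \<in> carrier (rel_cochains p X A)"
    using ab by (simp add: rel_cochains_iff cochains_def loc_zero_add loc_zero_smult)
  moreover have "(\<lambda>xs. \<phi> xs + c * \<psi> xs) = coboundary p X (\<lambda>xs. a xs + c * b xs)"
    by (auto simp: ab coboundary_eq_delta delta_add delta_smult)
  ultimately show ?thesis by (simp add: rel_coboundaries_def Suc)
qed

lemma AS_cocycles_coset:
  "AS_coboundaries q X A +>\<^bsub>AS_cocycles q X A\<^esub> AS_class q X \<phi>
    = (\<lambda>\<beta>. AS_class q X (\<lambda>xs. \<beta> xs + \<phi> xs)) ` rel_coboundaries q X A"
proof -
  have "AS_coboundaries q X A +>\<^bsub>AS_cocycles q X A\<^esub> AS_class q X \<phi>
      = (\<lambda>b. b \<oplus>\<^bsub>AS_cochains q X A\<^esub> AS_class q X \<phi>) ` AS_coboundaries q X A"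
    by (auto simp: a_r_coset_def' AS_cocycles_def)
  then show ?thesis
    by (simp add: AS_coboundaries_eq image_image AS_cochains_add)
qed

text \<open>A cocycle class that contains a coboundary has the subgroup of coboundaries itself
  as its coset, because translation by a member permutes that subgroup.\<close>

lemma AS_cohomology_zero_if:
  fixes \<phi> \<beta> :: "'a list \<Rightarrow> 'k::field"
  assumes "\<beta> \<in> rel_coboundaries q X A" "(\<lambda>xs. \<phi> xs - \<beta> xs) \<in> null_cochains q X"
  shows "AS_coboundaries q X A +>\<^bsub>AS_cocycles q X A\<^esub> AS_class q X \<phi> = \<zero>\<^bsub>AS_cohomology q X A\<^esub>"
proof -
  have eq: "AS_class q X \<phi> = AS_class q X \<beta>"
    using assms(2) by (simp add: AS_class_eq_iff)
  have "(\<lambda>\<alpha>. AS_class q X (\<lambda>xs. \<alpha> xs + \<beta> xs)) ` rel_coboundaries q X A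
      = AS_class q X ` rel_coboundaries q X A" (is "?L = ?R")
  proof
    show "?L \<subseteq> ?R"
      using rel_coboundaries_add_smult[OF _ assms(1), of _ 1] by auto
    show "?R \<subseteq> ?L"
    proof clarify
      fix \<alpha> :: "'a list \<Rightarrow> 'k" assume "\<alpha> \<in> rel_coboundaries q X A"
      then have "(\<lambda>xs. \<alpha> xs + (-1) * \<beta> xs) \<in> rel_coboundaries q X A"
        by (rule rel_coboundaries_add_smult[OF _ assms(1)])
      then show "AS_class q X \<alpha> \<in> ?L"
        by (rule rev_image_eqI) simp
    qed
  qed
  then have "AS_coboundaries q X A +>\<^bsub>AS_cocycles q X A\<^esub> AS_class q X \<phi>
      = AS_coboundaries q X A"
    unfolding eq AS_cocycles_coset by (simp only: AS_coboundaries_eq)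
  then show ?thesis
    by (simp add: AS_cohomology_def quotient_module_def)
qed

text \<open>The eigenvalue equation pulled down to representatives: equality of two iterated cosets
  is used only through the membership of one representative, and the two coboundaries that appear, one
  for each occurrence of the eigenvector, are collected in \<open>\<beta>\<close>.\<close>

lemma AS_eigenvalueE:
  assumes "is_eigenvalue (AS_cohomology q X A) (AS_induced q X A g) \<mu>" "continuous_map X X g"
  obtains \<phi> \<beta> where "\<phi> \<in> carrier (rel_cochains q X A)"
    "coboundary q X \<phi> \<in> null_cochains (Suc q) X" "\<beta> \<in> rel_coboundaries q X A"
    "(\<lambda>xs. pullback q X g \<phi> xs - \<mu> * \<phi> xs - \<beta> xs) \<in> null_cochains q X"
    "\<And>\<alpha>. \<alpha> \<in> rel_coboundaries q X A \<Longrightarrow> (\<lambda>xs. \<phi> xs - \<alpha> xs) \<notin> null_cochains q X"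
proof -
  let ?B = "AS_coboundaries q X A" and ?Z = "AS_cocycles q X A"
  from assms(1) obtain v where v: "v \<in> carrier (AS_cohomology q X A)"
      "v \<noteq> \<zero>\<^bsub>AS_cohomology q X A\<^esub>"
      "AS_induced q X A g v = \<mu> \<odot>\<^bsub>AS_cohomology q X A\<^esub> v"
    by (auto simp: is_eigenvalue_def)
  from v(1) obtain z where z: "z \<in> carrier ?Z" "v = ?B +>\<^bsub>?Z\<^esub> z"
    by (auto simp: AS_cohomology_def quotient_module_def A_RCOSETS_def')
  from z(1) obtain \<phi> where \<phi>: "\<phi> \<in> carrier (rel_cochains q X A)" "z = AS_class q X \<phi>"
      "AS_coboundary q X A z = \<zero>\<^bsub>AS_cochains (Suc q) X A\<^esub>"
    by (auto simp: AS_cocycles_def AS_cochains_carrier)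
  have d\<phi>: "coboundary q X \<phi> \<in> null_cochains (Suc q) X"
    using \<phi>(3) by (simp add: \<phi>(2) AS_coboundary_class AS_cochains_zero AS_class_eq_iff)
  have vim: "v = (\<lambda>\<beta>. AS_class q X (\<lambda>xs. \<beta> xs + \<phi> xs)) ` rel_coboundaries q X A"
    by (simp add: z(2) \<phi>(2) AS_cocycles_coset)
  have "AS_class q X \<phi> \<in> v"
    unfolding vim by (rule rev_image_eqI[OF rel_coboundaries_zero]) simp
  moreover have "AS_class q X (pullback q X g \<phi>)
      \<in> ?B +>\<^bsub>?Z\<^esub> AS_pullback q X A g (AS_class q X \<phi>)"
    unfolding AS_pullback_class[OF assms(2)] AS_cocycles_coset
    by (rule rev_image_eqI[OF rel_coboundaries_zero]) simp
  ultimately have "AS_class q X (pullback q X g \<phi>) \<in> AS_induced q X A g v"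
    by (auto simp: AS_induced_def quotient_map_to_def)
  also have "\<dots> = (\<Union>d\<in>v. ?B +>\<^bsub>?Z\<^esub> (\<mu> \<odot>\<^bsub>AS_cochains q X A\<^esub> d))"
    unfolding v(3) by (simp add: AS_cohomology_def quotient_module_def AS_cocycles_def)
  finally obtain d where d: "d \<in> v"
      "AS_class q X (pullback q X g \<phi>) \<in> ?B +>\<^bsub>?Z\<^esub> (\<mu> \<odot>\<^bsub>AS_cochains q X A\<^esub> d)"
    by blast
  from d(1) obtain \<beta>1 where \<beta>1: "\<beta>1 \<in> rel_coboundaries q X A"
      "d = AS_class q X (\<lambda>xs. \<beta>1 xs + \<phi> xs)"
    unfolding vim by blast
  from d(2) obtain \<beta>2 where \<beta>2: "\<beta>2 \<in> rel_coboundaries q X A"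
      "AS_class q X (pullback q X g \<phi>) = AS_class q X (\<lambda>xs. \<beta>2 xs + \<mu> * (\<beta>1 xs + \<phi> xs))"
    unfolding \<beta>1(2) AS_cochains_smult AS_cocycles_coset by blast
  have "(\<lambda>xs. \<beta>2 xs + \<mu> * \<beta>1 xs) \<in> rel_coboundaries q X A"
    by (rule rel_coboundaries_add_smult[OF \<beta>2(1) \<beta>1(1)])
  moreover have "(\<lambda>xs. pullback q X g \<phi> xs - \<mu> * \<phi> xs - (\<beta>2 xs + \<mu> * \<beta>1 xs)) \<in> null_cochains q X"
    using \<beta>2(2) by (simp add: AS_class_eq_iff algebra_simps)
  moreover have "(\<lambda>xs. \<phi> xs - \<alpha> xs) \<notin> null_cochains q X" if "\<alpha> \<in> rel_coboundaries q X A" for \<alpha>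
    using AS_cohomology_zero_if[OF that] v(2) by (auto simp: z(2) \<phi>(2))
  ultimately show ?thesis by (intro that[OF \<phi>(1) d\<phi>])
qed

text \<open>In the empty space every cochain is null, and otherwise attraction forces \<open>K \<noteq> {}\<close>.
  Passing between relative cochains, which are extended by zero, and unrestricted functions
  on lists changes nothing on tuples of points of \<open>X\<close>, and local vanishing only concerns those.\<close>

lemma attractor_no_nonzero_eigenvalue:
  fixes \<mu> :: "'k::field"
  assumes "paracompact_space X" "Hausdorff_space X" "continuous_map X X g"
    and att: "asymptotically_stable_attractor X g K"
    and "is_eigenvalue (AS_cohomology q X K) (AS_induced q X K g) \<mu>"
  shows "\<mu> = 0"
proof (rule ccontr)
  assume \<mu>: "\<mu> \<noteq> 0"
  obtain \<phi> \<beta> where \<phi>: "\<phi> \<in> carrier (rel_cochains q X K)"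
      and d\<phi>: "coboundary q X \<phi> \<in> null_cochains (Suc q) X"
      and \<beta>: "\<beta> \<in> rel_coboundaries q X K"
      and eig: "(\<lambda>xs. pullback q X g \<phi> xs - \<mu> * \<phi> xs - \<beta> xs) \<in> null_cochains q X"
      and nz: "\<And>\<alpha>. \<alpha> \<in> rel_coboundaries q X K \<Longrightarrow> (\<lambda>xs. \<phi> xs - \<alpha> xs) \<notin> null_cochains q X"
    using AS_eigenvalueE[OF assms(5,3)] by blast
  have \<phi>c: "\<phi> \<in> cochains q X" and \<phi>K: "loc_zero (Suc q) X K \<phi>"
    using \<phi> by (simp_all add: rel_cochains_iff)
  have KX: "K \<subseteq> topspace X" by (rule attractor_subset_topspace[OF att])
  have ne: "K \<noteq> {}"
  proof (rule attractor_nonempty[OF att], rule notI)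
    assume "topspace X = {}"
    then have "(\<lambda>xs. \<phi> xs - 0) \<in> null_cochains q X"
      using \<phi>c by (simp add: null_cochains_iff loc_zero_def)
    then show False using nz[OF rel_coboundaries_zero] by simp
  qed
  have "loc_zero (Suc (Suc q)) X UNIV (coboundary q X \<phi>)"
    using d\<phi> by (simp add: null_cochains_iff)
  then have dz: "loc_zero (Suc (Suc q)) X UNIV (delta \<phi>)"
    by (rule loc_zero_cong) (simp add: coboundary_eq_delta)
  have "\<exists>b. loc_zero q X K b \<and> (\<forall>xs\<in>tups (Suc q) (topspace X). \<beta> xs = delta b xs)"
  proof (cases q)
    case 0
    then show ?thesis
      using \<beta> by (intro exI[of _ "\<lambda>xs. 0"]) (simp add: rel_coboundaries_def)
  next
    case (Suc p)
    then obtain b where "b \<in> carrier (rel_cochains p X K)" "\<beta> = coboundary p X b"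
      using \<beta> by (auto simp: rel_coboundaries_def)
    then show ?thesis
      by (intro exI[of _ b]) (simp add: Suc rel_cochains_iff coboundary_eq_delta)
  qed
  then obtain b where b: "loc_zero q X K b" "\<And>xs. xs \<in> tups (Suc q) (topspace X) \<Longrightarrow> \<beta> xs = delta b xs"
    by blast
  have "loc_zero (Suc q) X UNIV (\<lambda>xs. pullback q X g \<phi> xs - \<mu> * \<phi> xs - \<beta> xs)"
    using eig by (simp add: null_cochains_iff)
  then have "loc_zero (Suc q) X UNIV (\<lambda>xs. \<phi> (map g xs) - \<mu> * \<phi> xs - delta b xs)"
    by (rule loc_zero_cong) (simp add: pullback_def tuples_eq_tups b(2))
  then obtain \<gamma> where \<gamma>: "loc_zero q X K \<gamma>" "loc_zero (Suc q) X UNIV (\<lambda>xs. \<phi> xs - delta \<gamma> xs)"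
    using eigencocycle_is_coboundary[OF paracompact_Hausdorff_imp_regular_space[OF assms(1,2)]
        assms(2) att assms(3) ne \<mu> \<phi>K dz b(1)] by blast
  have "\<exists>\<alpha>\<in>rel_coboundaries q X K. \<alpha> \<in> cochains q X \<and>
      (\<forall>xs\<in>tups (Suc q) (topspace X). \<alpha> xs = delta \<gamma> xs)"
  proof (cases q)
    case 0
    obtain p where p: "p \<in> K" "p \<in> topspace X" using ne KX by blast
    then have "\<gamma> [] = 0"
      using loc_zeroD[OF \<gamma>(1) p(2,1)] by (auto simp: 0 tups_def)
    then have "delta \<gamma> xs = 0" if "length xs = 1" for xs
      using that by (cases xs) auto
    then show ?thesis
      using rel_coboundaries_zero[of q X K]
      by (intro bexI[of _ "\<lambda>xs. 0"]) (auto simp: 0 cochains_def tups_def)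
  next
    case (Suc p)
    define \<gamma>' where "\<gamma>' xs = (if xs \<in> tups q (topspace X) then \<gamma> xs else 0)" for xs
    have "loc_zero q X K \<gamma>'"
      by (rule loc_zero_cong[OF \<gamma>(1)]) (auto simp: \<gamma>'_def tups_def)
    then have "\<gamma>' \<in> carrier (rel_cochains p X K)"
      by (simp add: rel_cochains_iff Suc) (simp add: cochains_def \<gamma>'_def tuples_eq_tups Suc)
    moreover have "coboundary p X \<gamma>' xs = delta \<gamma> xs" if "xs \<in> tups (Suc q) (topspace X)" for xs
    proof -
      have "delta \<gamma>' xs = delta \<gamma> xs"
        by (rule delta_cong) (use that in \<open>auto simp: \<gamma>'_def tups_def\<close>)
      then show ?thesis using that by (simp add: coboundary_eq_delta Suc)
    qed
    moreover have "coboundary p X \<gamma>' \<in> cochains q X"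
      by (simp add: cochains_def coboundary_eq_delta tuples_eq_tups Suc)
    ultimately show ?thesis
      by (auto simp: rel_coboundaries_def Suc)
  qed
  then obtain \<alpha> where \<alpha>: "\<alpha> \<in> rel_coboundaries q X K" "\<alpha> \<in> cochains q X"
      "\<And>xs. xs \<in> tups (Suc q) (topspace X) \<Longrightarrow> \<alpha> xs = delta \<gamma> xs"
    by blast
  have "loc_zero (Suc q) X UNIV (\<lambda>xs. \<phi> xs - \<alpha> xs)"
    by (rule loc_zero_cong[OF \<gamma>(2)]) (simp add: \<alpha>(3))
  then have "(\<lambda>xs. \<phi> xs - \<alpha> xs) \<in> null_cochains q X"
    using \<phi>c \<alpha>(2) by (simp add: null_cochains_iff) (simp add: cochains_def)
  then show False using nz[OF \<alpha>(1)] by blast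
qed

theorem corollary8:
  fixes Z :: "'a topology" and g :: "'a \<Rightarrow> 'a" and K :: "'a set"
  assumes "paracompact_space Z" and "Hausdorff_space Z"
    and "continuous_map Z Z g"
    and "asymptotically_stable_attractor Z g K"
  shows "(\<forall>q. \<forall>\<mu>::rat.
            is_eigenvalue (AS_cohomology q Z K) (AS_induced q Z K g) \<mu> \<longrightarrow> \<mu> = 0) \<and>
         (\<forall>q. \<forall>\<mu>::complex.
            is_eigenvalue (AS_cohomology q Z K) (AS_induced q Z K g) \<mu> \<longrightarrow> \<mu> = 0)"
  by (intro conjI allI impI; erule attractor_no_nonzero_eigenvalue[OF assms])

end
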